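(* Let $i,j$ be real numbers with $0<j\le i<1$ and $i+j=1$. Let $I\subset\mathbb{R}$ be a compact interval and let $f\in C^{(2)}(I)$ satisfy $f''(x)\neq 0$ for all $x\in I$. Then the set $\mathrm{Bad}^f(i,j):=\{x\in I:(x,f(x))\in\mathrm{Bad}(i,j)\}$ is a $1/2$-winning subset of $I$.
   Context: For $t\in\mathbb{R}$, $\|t\|$ denotes the distance from $t$ to the nearest integer. $\mathrm{Bad}(i,j)$ is the set of $(x,y)\in\mathbb{R}^2$ for which there is $c(x,y)>0$ with $\max\{\|qx\|^{1/i},\|qy\|^{1/j}\}>c(x,y)\,q^{-1}$ for all $q\in\mathbb{N}$. Schmidt's $(\alpha,\beta)$-game on $I$: for $0<\alpha,\beta<1$, player B chooses a closed interval $B_0\subset I$; then A chooses a closed interval $A_0\subset B_0$ of length $\alpha|B_0|$; then B chooses a closed interval $B_1\subset A_0$ of length $\beta|A_0|$, and so on alternately, giving nested intervals $B_0\supset A_0\supset B_1\supset A_1\supset\cdots$. A set $X\subset I$ is $(\alpha,\beta)$-winning if A can play so that the unique point of $\bigcap_n B_n$ lies in $X$ regardless of how B plays; it is $\alpha$-winning if it is $(\alpha,\beta)$-winning for every $\beta\in(0,1)$. *)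

theory Defs
  imports "HOL-Analysis.Analysis"
begin

definition dist_int :: "real \<Rightarrow> real" where
  "dist_int t = \<bar>t - of_int (round t)\<bar>"

definition Bad :: "real \<Rightarrow> real \<Rightarrow> (real \<times> real) set" where
  "Bad i j = {(x, y). \<exists>c>0. \<forall>q::nat. q \<ge> 1 \<longrightarrow>
     max (dist_int (real q * x) powr (1 / i)) (dist_int (real q * y) powr (1 / j)) > c / real q}"

definition Bad_curve :: "real set \<Rightarrow> (real \<Rightarrow> real) \<Rightarrow> real \<Rightarrow> real \<Rightarrow> real set" where
  "Bad_curve I f i j = {x \<in> I. (x, f x) \<in> Bad i j}"

text \<open>The intervals played in Schmidt's game are nondegenerate: if player B could open with a
  single point, no set missing a point of the board would be winning.\<close>

definition closed_interval :: "real set \<Rightarrow> bool" where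
  "closed_interval J \<longleftrightarrow> (\<exists>u v. u < v \<and> J = {u..v})"

definition legal_move :: "real \<Rightarrow> real set \<Rightarrow> real set \<Rightarrow> bool" where
  "legal_move \<gamma> J K \<longleftrightarrow> closed_interval K \<and> K \<subseteq> J \<and> measure lborel K = \<gamma> * measure lborel J"

text \<open>A strategy for A maps the list of B's moves so far to A's next move; A's own earlier
  moves are determined by these, so they need not be arguments.\<close>

definition reply :: "(real set list \<Rightarrow> real set) \<Rightarrow> (nat \<Rightarrow> real set) \<Rightarrow> nat \<Rightarrow> real set" where
  "reply \<sigma> B n = \<sigma> (map B [0..<Suc n])"

text \<open>Only the moves B 0, ..., B n are constrained here.\<close>

definition B_legal_upto ::
    "real \<Rightarrow> real set \<Rightarrow> (real set list \<Rightarrow> real set) \<Rightarrow> (nat \<Rightarrow> real set) \<Rightarrow> nat \<Rightarrow> bool" where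
  "B_legal_upto \<beta> I \<sigma> B n \<longleftrightarrow>
     closed_interval (B 0) \<and> B 0 \<subseteq> I \<and> (\<forall>k<n. legal_move \<beta> (reply \<sigma> B k) (B (Suc k)))"

text \<open>Legality of A's moves is required at every finite stage that B can reach legally, and not
  only along infinite plays; otherwise A could win vacuously by a move that leaves B
  without an answer.\<close>

definition winning_strategy ::
    "real \<Rightarrow> real \<Rightarrow> real set \<Rightarrow> real set \<Rightarrow> (real set list \<Rightarrow> real set) \<Rightarrow> bool" where
  "winning_strategy \<alpha> \<beta> I X \<sigma> \<longleftrightarrow>
     (\<forall>B n. B_legal_upto \<beta> I \<sigma> B n \<longrightarrow> legal_move \<alpha> (B n) (reply \<sigma> B n)) \<and>
     (\<forall>B. (\<forall>n. B_legal_upto \<beta> I \<sigma> B n) \<longrightarrow> (\<exists>x\<in>X. (\<Inter>n. B n) = {x}))"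

definition game_winning :: "real \<Rightarrow> real \<Rightarrow> real set \<Rightarrow> real set \<Rightarrow> bool" where
  "game_winning \<alpha> \<beta> I X \<longleftrightarrow> X \<subseteq> I \<and> (\<exists>\<sigma>. winning_strategy \<alpha> \<beta> I X \<sigma>)"

definition alpha_winning :: "real \<Rightarrow> real set \<Rightarrow> real set \<Rightarrow> bool" where
  "alpha_winning \<alpha> I X \<longleftrightarrow> (\<forall>\<beta>. 0 < \<beta> \<and> \<beta> < 1 \<longrightarrow> game_winning \<alpha> \<beta> I X)"

end

theory Submission
  imports Defs
begin

text \<open>
  The point (x, f x) lies in Bad i j as soon as, for some c > 0, x lies in no neighbourhood
  |qx - p| \<le> c q^(-i), |q f(x) - r| \<le> c q^(-j) of a rational point (p/q, r/q). Player A has to avoid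
  countably many such obstacles while the intervals shrink by the factor 1/R = \<beta>/2 in every round.

  An interval much shorter than the current one meets both halves of it only if it contains the
  midpoint, and from then on it reaches beyond an end of the interval in play. So if an obstacle
  counts 2 while it is inside the interval, 1 once it sticks out and 0 when it is disjoint, the
  better half has at most half of the total. Hence A wins if, at every stage, boundedly many new
  obstacles are declared for each deadline, all deadlines being sufficiently far in the future.

  Obstacles with denominator q about Q = Q k are dealt with when the interval has length comparable to
  Q^(-1-i). A determinant estimate then puts all of them on one rational line Ax - By + C = 0
  with |A| \<le> Q^i, |B| \<le> Q^j, and they lie in the strip |Ax - B f(x) + C| \<le> 2c/Q. Long components of such
  strips are declared much earlier. Only one line has to be considered at a time,
  because two of them meet in a rational point of far smaller denominator whose neighbourhood would
  contain the whole interval, although it has been avoided before; f'' being bounded and bounded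
  away from zero controls f and the slope A - B f' on a component by its length.
\<close>

subsection \<open>Playing against shrinking obstacles\<close>

text \<open>As \<beta> tends to 1, \<open>R\<close> = 2/\<beta> tends to 2, so no constant can be
  absorbed by a large ratio of consecutive lengths. Choosing a half gains a factor 2 only, and all
  constants are paid for in stages, as powers \<open>R powr \<kappa>\<close>. Since \<kappa> also
  has to dominate \<rho> and 1/\<rho>, the scheme depends on the opening move of B.

  Collinearity leaves strips whose components may be far longer than the neighbourhoods that they
  contain. A component longer than c Q^(-1-i) by a factor of about R^m is declared s = m div 10
  stages before its deadline. The lead s must be at least 14 for the potential, whence the 140 in
  \<open>m0\<close>. It must also be small against m: on the interval s stages before the deadline
  the slope has gained about R^(m-s) over Q^i, whereas the form has lost only about R^(2s) over c/Q.
  This imbalance gives the intersection of two such lines a denominator so small that the scale of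
  that denominator was finished before the declaration.\<close>

definition touch_weight :: "real \<times> real \<Rightarrow> real \<Rightarrow> real \<Rightarrow> real" where
  "touch_weight p y z =
     (if snd p < y \<or> z < fst p then 0 else if y < fst p \<and> snd p < z then 2 else 1)"

lemma touch_weight_nonneg: "0 \<le> touch_weight p y z"
  and touch_weight_le_2: "touch_weight p y z \<le> 2"
  by (auto simp: touch_weight_def)

lemma touch_weight_mono:
  assumes "y \<le> y'" "z' \<le> z"
  shows "touch_weight p y' z' \<le> touch_weight p y z"
  using assms by (auto simp: touch_weight_def)

text \<open>The length bound also settles the intervals that already stick out: starting at or
  beyond an end and being shorter than half of \<open>{y..z}\<close>, such an interval cannot reach
  the midpoint, so its weight 1 passes to one half only.\<close>

lemma touch_weight_halves:
  assumes "2 * (snd p - fst p) < z - y"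
  shows "touch_weight p y ((y + z) / 2) + touch_weight p ((y + z) / 2) z \<le> touch_weight p y z"
  using assms by (auto simp: touch_weight_def field_simps)

lemma touch_weight_less_1_disjoint:
  assumes "touch_weight p y z < 1" "x \<in> {fst p..snd p}"
  shows "x \<notin> {y..z}"
  using assms by (auto simp: touch_weight_def split: if_splits)

lemma touch_weight_sum_halves:
  fixes S :: "'c set"
  assumes "\<And>p. p \<in> S \<Longrightarrow> 2 * (snd (g p) - fst (g p)) < z - y" "\<And>p. p \<in> S \<Longrightarrow> 0 \<le> h p"
    and "(\<Sum>p\<in>S. h p * touch_weight (g p) y ((y + z) / 2)) > (\<Sum>p\<in>S. h p * touch_weight (g p) y z) / 2"
  shows "(\<Sum>p\<in>S. h p * touch_weight (g p) ((y + z) / 2) z) \<le> (\<Sum>p\<in>S. h p * touch_weight (g p) y z) / 2"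
proof -
  have "(\<Sum>p\<in>S. h p * touch_weight (g p) y ((y + z) / 2)) + (\<Sum>p\<in>S. h p * touch_weight (g p) ((y + z) / 2) z)
     = (\<Sum>p\<in>S. h p * (touch_weight (g p) y ((y + z) / 2) + touch_weight (g p) ((y + z) / 2) z))"
    by (simp add: sum.distrib distrib_left)
  also have "\<dots> \<le> (\<Sum>p\<in>S. h p * touch_weight (g p) y z)"
    using assms(1,2) by (intro sum_mono mult_left_mono touch_weight_halves) auto
  finally show ?thesis using assms(3) by simp
qed

text \<open>The 4 stands for two intervals from each of the two kinds of obstacles. With \<delta>
  the length of the interval at the deadline, the intervals are short enough for
  \<open>touch_weight_halves\<close> at all earlier stages as well.\<close>

definition covering :: "real set \<Rightarrow> real \<Rightarrow> (real \<times> real) set \<Rightarrow> bool" where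
  "covering Y \<delta> \<J> \<longleftrightarrow> finite \<J> \<and> card \<J> \<le> 4 \<and> (\<forall>p\<in>\<J>. 2 * (snd p - fst p) < \<delta>) \<and>
     Y \<subseteq> (\<Union>p\<in>\<J>. {fst p..snd p})"

lemma coveringD: "covering Y \<delta> \<J> \<Longrightarrow> p \<in> \<J> \<Longrightarrow> 2 * (snd p - fst p) < \<delta>"
  by (simp add: covering_def)

lemma covering_empty: "covering {} \<delta> {}"
  by (simp add: covering_def)

lemma closed_intervalI: "u < v \<Longrightarrow> closed_interval {u..v}"
  by (auto simp: closed_interval_def)

lemma closed_intervalE:
  assumes "closed_interval K"
  obtains y z where "y < z" "K = {y..z}"
  using assms by (auto simp: closed_interval_def)

lemma closed_interval_Inf_Sup:
  assumes "closed_interval K"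
  shows "K = {Inf K..Sup K}" "Inf K < Sup K" "measure lborel K = Sup K - Inf K"
  using assms by (auto elim!: closed_intervalE)

text \<open>The factor 2/3 per stage leaves room for new obstacles: a potential of at most 1/2 is halved by
  A's move and multiplied by 3/2 on passing to the next stage, and the new obstacles add at most
  the sum of 4 * 2 * (2/3)^s over s \<ge> 14, which is less than 1/8. At its deadline an obstacle has
  weight at most 3/8 and hence weight 0.\<close>

lemma avoid_all:
  fixes y z :: "nat \<Rightarrow> real" and Z :: "nat \<Rightarrow> nat \<Rightarrow> real set" and C :: "nat \<Rightarrow> nat \<Rightarrow> (real \<times> real) set"
    and bnd :: "nat \<Rightarrow> nat"
  defines "S \<equiv> \<lambda>n. (SIGMA n':{..n}. SIGMA N:{Suc n..bnd n'}. C n' N)"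
  defines "\<Phi> \<equiv> \<lambda>n u v. \<Sum>t\<in>S n. (2/3) ^ (fst (snd t) - n) * touch_weight (snd (snd t)) u v"
  assumes mono: "\<And>n. y n \<le> y (Suc n)" "\<And>n. z (Suc n) \<le> z n"
    and half: "\<And>n. (\<And>n' N p. n' \<le> n \<Longrightarrow> p \<in> C n' N \<Longrightarrow> 2 * (snd p - fst p) < \<rho> * r ^ N) \<Longrightarrow>
        \<Phi> n (y (Suc n)) (z (Suc n)) \<le> \<Phi> n (y n) (z n) / 2"
    and cover: "\<And>n N. (\<And>n' N. N \<le> n \<Longrightarrow> Z n' N \<inter> {y n..z n} = {}) \<Longrightarrow>
        covering (Z n N \<inter> {y n..z n}) (\<rho> * r ^ N) (C n N) \<and> (N < n + 14 \<longrightarrow> C n N = {})"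
    and bnd: "\<And>n N. Z n N \<noteq> {} \<Longrightarrow> n + 14 \<le> N \<and> N \<le> bnd n"
  shows "N \<le> n \<Longrightarrow> Z n' N \<inter> {y n..z n} = {}"
proof -
  \<comment> \<open>\<open>T n\<close> collects what was declared strictly before stage n with
    deadline at least n, so \<open>\<Psi> n\<close> is the potential just before the declarations of
    stage n. \<open>S n\<close> and \<open>\<Phi> n\<close> belong to the moment after them, when
    the deadline n has expired.\<close>
  define T where "T = (\<lambda>n. SIGMA n':{..<n}. SIGMA N:{n..bnd n'}. C n' N)"
  define \<Psi> where "\<Psi> = (\<lambda>n. \<Sum>t\<in>T n. (2/3) ^ (fst (snd t) - n) * touch_weight (snd (snd t)) (y n) (z n))"
  \<comment> \<open>Covers are guaranteed only where everything expired has been avoided, and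
    avoidance follows from the potential of those covers; hence one simultaneous induction.\<close>
  have "(\<forall>n' N. N \<le> n \<longrightarrow> Z n' N \<inter> {y n..z n} = {}) \<and>
        (\<forall>n'\<le>n. \<forall>N. covering (Z n' N \<inter> {y n'..z n'}) (\<rho> * r ^ N) (C n' N) \<and> (N < n' + 14 \<longrightarrow> C n' N = {})) \<and>
        \<Psi> n \<le> 3/8" for n
  proof (induction n rule: less_induct)
    case (less n)
    have cov: "covering (Z n' N \<inter> {y n'..z n'}) (\<rho> * r ^ N) (C n' N)" "N < n' + 14 \<Longrightarrow> C n' N = {}" if "n' < n" for n' N
      using less that by auto
    have finC: "finite (C n' N)" if "n' < n" for n' N
      using cov that by (auto simp: covering_def)
    have finT: "finite (T n)"
      unfolding T_def using finC by (intro finite_SigmaI) auto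
    have psi: "\<Psi> n \<le> 3/8"
    proof (cases n)
      case 0
      then show ?thesis by (simp add: \<Psi>_def T_def)
    next
      case (Suc m)
      have m: "m < n" using Suc by simp
      have TS: "T n = S m"
        using Suc by (auto simp: T_def S_def less_Suc_eq_le)
      define U where "U = (SIGMA n':{m}. SIGMA N:{m+14..bnd n'}. C n' N)"
      have finTm: "finite (T m)"
        unfolding T_def using finC m by (intro finite_SigmaI) auto
      have finU: "finite U"
        unfolding U_def using finC m by (intro finite_SigmaI) auto
      have sub: "S m \<subseteq> T m \<union> U"
      proof
        fix t assume "t \<in> S m"
        then obtain n' N p where t: "t = (n', N, p)" "n' \<le> m" "Suc m \<le> N" "N \<le> bnd n'" "p \<in> C n' N"
          by (auto simp: S_def)
        show "t \<in> T m \<union> U"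
        proof (cases "n' = m")
          case True
          then have "\<not> N < m + 14" using cov(2)[of m N] m t by auto
          then show ?thesis using True t by (auto simp: U_def)
        qed (use t in \<open>auto simp: T_def\<close>)
      qed
      let ?h = "\<lambda>t::nat \<times> nat \<times> real \<times> real. (2/3) ^ (fst (snd t) - m) * touch_weight (snd (snd t)) (y m) (z m)"
      have "\<Phi> m (y m) (z m) \<le> sum ?h (T m \<union> U)"
        unfolding \<Phi>_def using sub finTm finU
        by (intro sum_mono2) (auto intro!: mult_nonneg_nonneg touch_weight_nonneg)
      also have "\<dots> \<le> sum ?h (T m) + sum ?h U"
        using sum.union_inter[OF finTm finU, of ?h]
          sum_nonneg[of "T m \<inter> U" ?h] touch_weight_nonneg by fastforce
      also have "sum ?h (T m) \<le> 3/8"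
        using less m by (simp add: \<Psi>_def)
      also have "sum ?h U \<le> 1/8"
      proof -
        have "sum ?h U \<le> (\<Sum>t\<in>U. (2/3) ^ (fst (snd t) - m) * 2)"
          by (intro sum_mono mult_left_mono touch_weight_le_2) auto
        also have "\<dots> = (\<Sum>N\<in>{m+14..bnd m}. \<Sum>p\<in>C m N. (2/3) ^ (N - m) * 2)"
        proof -
          have "U = Pair m ` Sigma {m+14..bnd m} (C m)" by (auto simp: U_def)
          then have "(\<Sum>t\<in>U. (2/3::real) ^ (fst (snd t) - m) * 2) = (\<Sum>t\<in>Sigma {m+14..bnd m} (C m). (2/3) ^ (fst t - m) * 2)"
            by (simp add: sum.reindex inj_on_def)
          also have "\<dots> = (\<Sum>N\<in>{m+14..bnd m}. \<Sum>p\<in>C m N. (2/3) ^ (N - m) * 2)"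
            using finC m by (subst sum.Sigma) (auto intro!: sum.cong)
          finally show ?thesis .
        qed
        also have "\<dots> \<le> (\<Sum>N\<in>{m+14..bnd m}. (2/3) ^ (N - m) * 8)"
        proof (intro sum_mono)
          fix N
          have "card (C m N) \<le> 4" using cov(1)[of m N] m by (auto simp: covering_def)
          then have "real (card (C m N)) * ((2/3) ^ (N - m) * 2) \<le> 4 * ((2/3) ^ (N - m) * 2)"
            by (intro mult_right_mono) auto
          then show "(\<Sum>p\<in>C m N. (2/3::real) ^ (N - m) * 2) \<le> (2/3) ^ (N - m) * 8"
            by simp
        qed
        \<comment> \<open>Counting from the lead 14 turns the sum into a geometric series, whose
          bound does not depend on \<open>bnd m\<close>.\<close>
        also have "\<dots> \<le> (\<Sum>k\<in>{..bnd m}. (2/3) ^ k * ((2/3)^14 * 8))"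
        proof -
          have "(\<Sum>N\<in>{m+14..bnd m}. (2/3::real) ^ (N - m) * 8)
              = (\<Sum>k\<in>(\<lambda>N. N - (m + 14)) ` {m+14..bnd m}. (2/3) ^ k * ((2/3)^14 * 8))"
          proof (subst sum.reindex)
            show "inj_on (\<lambda>N. N - (m + 14)) {m+14..bnd m}"
              by (auto simp: inj_on_def)
            show "(\<Sum>N\<in>{m+14..bnd m}. (2/3::real) ^ (N - m) * 8)
              = (\<Sum>N\<in>{m+14..bnd m}. ((\<lambda>k. (2/3) ^ k * ((2/3)^14 * 8)) \<circ> (\<lambda>N. N - (m + 14))) N)"
            proof (rule sum.cong[OF refl])
              fix N assume "N \<in> {m+14..bnd m}"
              then have "N - m = (N - (m + 14)) + 14" by auto
              then show "(2/3::real) ^ (N - m) * 8 = ((\<lambda>k. (2/3) ^ k * ((2/3)^14 * 8)) \<circ> (\<lambda>N. N - (m + 14))) N"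
                by (simp only: power_add comp_def mult.assoc)
            qed
          qed
          also have "\<dots> \<le> (\<Sum>k\<in>{..bnd m}. (2/3) ^ k * ((2/3)^14 * 8))"
            by (intro sum_mono2) auto
          finally show ?thesis .
        qed
        also have "\<dots> = (\<Sum>k\<le>bnd m. (2/3) ^ k) * ((2/3)^14 * 8)"
          by (simp add: sum_distrib_right)
        also have "\<dots> \<le> 3 * ((2/3)^14 * 8)"
        proof (intro mult_right_mono)
          show "(\<Sum>k\<le>bnd m. (2/3::real) ^ k) \<le> 3"
            by (simp add: lessThan_Suc_atMost[symmetric] sum_gp_strict)
        qed simp
        also have "\<dots> \<le> 1/8" by (simp add: power_divide)
        finally show ?thesis .
      qed
      finally have phi: "\<Phi> m (y m) (z m) \<le> 1/2" by simp
      have "\<Phi> m (y (Suc m)) (z (Suc m)) \<le> \<Phi> m (y m) (z m) / 2"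
        using m by (intro half coveringD[OF cov(1)]) auto
      with phi have "\<Phi> m (y n) (z n) \<le> 1/4" by (simp add: Suc)
      \<comment> \<open>All deadlines in \<open>S m\<close> exceed m, so the truncated difference
        really drops by one from stage m to stage n.\<close>
      moreover have "\<Psi> n = 3/2 * \<Phi> m (y n) (z n)"
      proof -
        have "(2/3::real) ^ (fst (snd t) - n) = 3/2 * (2/3) ^ (fst (snd t) - m)" if "t \<in> S m" for t
        proof -
          have "fst (snd t) - m = Suc (fst (snd t) - n)"
            using that Suc by (auto simp: S_def)
          then show ?thesis by simp
        qed
        then show ?thesis
          unfolding \<Psi>_def \<Phi>_def TS sum_distrib_left by (intro sum.cong refl) (simp add: mult.assoc)
      qed
      ultimately show ?thesis by simp
    qed
    have avoid: "Z n' N \<inter> {y n..z n} = {}" if "N \<le> n" for n' N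
    proof (rule ccontr)
      assume "Z n' N \<inter> {y n..z n} \<noteq> {}"
      then obtain x where x: "x \<in> Z n' N" "x \<in> {y n..z n}" by blast
      then have b: "n' + 14 \<le> N" "N \<le> bnd n'" using bnd by blast+
      have x': "x \<in> {y k..z k}" if "k \<le> n" for k
        using x(2) lift_Suc_mono_le[of y k n, OF mono(1) that] lift_Suc_antimono_le[of z k n, OF mono(2) that]
        by auto
      \<comment> \<open>A deadline before n is covered by the induction hypothesis at stage N,
        because x lies in that earlier interval too.\<close>
      have "N = n"
        using x x' less.IH[of N] that by (metis IntI empty_iff le_neq_implies_less order_refl)
      have "n' < n" using b that by simp
      then obtain p where p: "p \<in> C n' n" "x \<in> {fst p..snd p}"
        using cov(1)[of n' n] x(1) x'[of n'] \<open>N = n\<close> by (fastforce simp: covering_def)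
      let ?g = "\<lambda>t::nat \<times> nat \<times> real \<times> real. (2/3) ^ (fst (snd t) - n) * touch_weight (snd (snd t)) (y n) (z n)"
      have "(n', n, p) \<in> T n"
        using p \<open>n' < n\<close> b \<open>N = n\<close> by (simp add: T_def)
      moreover have "0 \<le> ?g t" for t by (simp add: touch_weight_nonneg)
      \<comment> \<open>At the deadline the exponent is 0, so the undamped touch weight is one of
        the summands.\<close>
      ultimately have "?g (n', n, p) \<le> sum ?g (T n)"
        using finT by (intro member_le_sum)
      then have "touch_weight p (y n) (z n) \<le> \<Psi> n"
        by (simp add: \<Psi>_def)
      with psi have "touch_weight p (y n) (z n) < 1" by simp
      from touch_weight_less_1_disjoint[OF this p(2)] x(2) show False by simp
    qed
    have "covering (Z n N \<inter> {y n..z n}) (\<rho> * r ^ N) (C n N) \<and> (N < n + 14 \<longrightarrow> C n N = {})" for N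
      using avoid by (intro cover) auto
    with avoid psi cov show ?case
      by (metis le_neq_implies_less)
  qed
  then show "N \<le> n \<Longrightarrow> Z n' N \<inter> {y n..z n} = {}" by blast
qed


text \<open>The set Z n N is declared at stage n and has to be avoided from stage N on. The cover may rely
  on everything with an expired deadline having been avoided.\<close>

definition avoidance_scheme ::
    "real \<Rightarrow> real set \<Rightarrow> real \<Rightarrow> (nat \<Rightarrow> nat \<Rightarrow> real set) \<Rightarrow> (nat \<Rightarrow> nat) \<Rightarrow> bool" where
  "avoidance_scheme r I \<rho> Z bnd \<longleftrightarrow>
     (\<forall>n N. Z n N \<noteq> {} \<longrightarrow> n + 14 \<le> N \<and> N \<le> bnd n) \<and>
     (\<forall>n N y. {y..y + \<rho> * r ^ n} \<subseteq> I \<longrightarrow>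
        (\<forall>n' N'. N' \<le> n \<longrightarrow> Z n' N' \<inter> {y..y + \<rho> * r ^ n} = {}) \<longrightarrow>
        (\<exists>\<J>. covering (Z n N \<inter> {y..y + \<rho> * r ^ n}) (\<rho> * r ^ N) \<J>))"

text \<open>The scheme may depend on the length \<rho> of the opening interval, which the strategy
  reads off the first entry of the history. A move of A followed by one of B multiplies the length
  by \<beta>/2.\<close>

lemma game_winning_if_avoidance:
  fixes a b \<beta> :: real
  assumes "0 < \<beta>" "\<beta> < 1" "X \<subseteq> {a..b}"
    and schemes: "\<And>\<rho>. 0 < \<rho> \<Longrightarrow> \<rho> \<le> b - a \<Longrightarrow>
      \<exists>Z bnd. avoidance_scheme (\<beta> / 2) {a..b} \<rho> Z bnd \<and> (\<forall>x\<in>{a..b}. (\<forall>n N. x \<notin> Z n N) \<longrightarrow> x \<in> X)"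
  shows "game_winning (1 / 2) \<beta> {a..b} X"
proof -
  define good where "good = (\<lambda>\<rho> (Z, bnd). avoidance_scheme (\<beta> / 2) {a..b} \<rho> Z bnd \<and>
      (\<forall>x\<in>{a..b}. (\<forall>n N. x \<notin> Z n N) \<longrightarrow> x \<in> X))"
  define Z where "Z = (\<lambda>\<rho>. fst (SOME p. good \<rho> p))"
  define bnd where "bnd = (\<lambda>\<rho>. snd (SOME p. good \<rho> p))"
  have good: "good \<rho> (Z \<rho>, bnd \<rho>)" if "0 < \<rho>" "\<rho> \<le> b - a" for \<rho>
  proof -
    have "\<exists>p. good \<rho> p" using schemes[OF that] by (auto simp: good_def)
    then show ?thesis unfolding Z_def bnd_def prod.collapse by (rule someI_ex)
  qed
  have scheme: "avoidance_scheme (\<beta> / 2) {a..b} \<rho> (Z \<rho>) (bnd \<rho>)" if "0 < \<rho>" "\<rho> \<le> b - a" for \<rho>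
    using good[OF that] by (simp add: good_def)
  have target: "x \<in> X" if "0 < \<rho>" "\<rho> \<le> b - a" "x \<in> {a..b}" "\<And>n N. x \<notin> Z \<rho> n N" for \<rho> x
    using good[OF that(1,2)] that(3,4) by (simp add: good_def)
  \<comment> \<open>The cover depends only on \<rho>, the stages and the interval of B at the
    declaration, so later rounds recover the same cover from the history. Below the lead 14 it is
    set to be empty: a cover chosen for an empty set could be nonempty and would then count in the
    potential.\<close>
  define cov where "cov = (\<lambda>\<rho> n N K. if N < n + 14 then {} else
     (SOME \<J>. covering (Z \<rho> n N \<inter> K) (\<rho> * (\<beta>/2) ^ N) \<J>))"
  define \<Phi> where "\<Phi> = (\<lambda>hs u v. let n = length hs - 1; \<rho> = measure lborel (hs ! 0) in
     \<Sum>t\<in>(SIGMA n':{..n}. SIGMA N:{Suc n..bnd \<rho> n'}. cov \<rho> n' N (hs ! n')).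
       (2/3) ^ (fst (snd t) - n) * touch_weight (snd (snd t)) u v)"
  define \<sigma> where "\<sigma> = (\<lambda>hs. let y = Inf (last hs); z = Sup (last hs); m = (y + z) / 2 in
     if \<Phi> hs y m \<le> \<Phi> hs y z / 2 then {y..m} else {m..z})"
  \<comment> \<open>This holds after every history, whether or not covers exist, because legality is
    demanded at all finite stages.\<close>
  have legal: "legal_move (1/2) K (\<sigma> hs)" if K: "closed_interval K" "last hs = K" for hs K
  proof -
    obtain y z where "y < z" "K = {y..z}" using K(1) by (rule closed_intervalE)
    moreover have "closed_interval {y..(y + z) / 2}" "closed_interval {(y + z) / 2..z}"
      using \<open>y < z\<close> by (auto intro!: closed_intervalI)
    ultimately show ?thesis
      using K(2) by (auto simp: \<sigma>_def legal_move_def Let_def field_simps)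
  qed
  have last_hist: "last (map B [0..<Suc n]) = B n" for B :: "nat \<Rightarrow> real set" and n
    by simp
  have closed: "closed_interval (B n)" if "B_legal_upto \<beta> {a..b} \<sigma> B n" for B n
    using that by (cases n) (auto simp: B_legal_upto_def legal_move_def)
  have "\<exists>x\<in>X. (\<Inter>n. B n) = {x}" if B: "\<And>n. B_legal_upto \<beta> {a..b} \<sigma> B n" for B
  proof -
    define y where "y = (\<lambda>n. Inf (B n))"
    define z where "z = (\<lambda>n. Sup (B n))"
    define \<rho> where "\<rho> = z 0 - y 0"
    note cl = closed[OF B]
    have B_eq: "B n = {y n..z n}" and yz: "y n < z n" and meas: "measure lborel (B n) = z n - y n" for n
      using closed_interval_Inf_Sup[OF cl[of n]] by (simp_all add: y_def z_def)
    have move: "legal_move \<beta> (reply \<sigma> B n) (B (Suc n))" for n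
      using B[of "Suc n"] by (simp add: B_legal_upto_def)
    have amove: "legal_move (1/2) (B n) (reply \<sigma> B n)" for n
      unfolding reply_def by (rule legal[OF cl last_hist[of B n]])
    have nest: "B (Suc n) \<subseteq> B n" for n
      using move[of n] amove[of n] by (auto simp: legal_move_def)
    have mono: "y n \<le> y (Suc n)" "z (Suc n) \<le> z n" for n
      using nest[of n] yz[of "Suc n"] unfolding B_eq by auto
    have len: "z n = y n + \<rho> * (\<beta>/2) ^ n" for n
    proof (induction n)
      case (Suc n)
      have "z (Suc n) - y (Suc n) = \<beta> * (1/2 * (z n - y n))"
        using move[of n] amove[of n] by (simp add: legal_move_def meas)
      with Suc show ?case by (simp add: algebra_simps)
    qed (simp add: \<rho>_def)
    have sub: "B n \<subseteq> {a..b}" for n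
    proof (induction n)
      case 0 show ?case using B[of 0] by (simp add: B_legal_upto_def)
    next
      case (Suc n) then show ?case using nest[of n] by auto
    qed
    have "{y 0..z 0} \<subseteq> {a..b}" using sub[of 0] B_eq[of 0] by simp
    then have rho: "0 < \<rho>" "\<rho> \<le> b - a"
      using yz[of 0] by (auto simp: \<rho>_def)
    note sch = scheme[OF rho, unfolded avoidance_scheme_def]
    have meas0: "measure lborel (B 0) = \<rho>" by (simp add: meas \<rho>_def)
    have hist0: "map B [0..<Suc n] ! 0 = B 0" for n by (simp add: upt_conv_Cons del: upt_Suc)
    have Phi_eq: "\<Phi> (map B [0..<Suc n]) u v =
       (\<Sum>t\<in>(SIGMA n':{..n}. SIGMA N:{Suc n..bnd \<rho> n'}. cov \<rho> n' N (B n')).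
         (2/3) ^ (fst (snd t) - n) * touch_weight (snd (snd t)) u v)" for n u v
    proof -
      have "(SIGMA n':{..n}. SIGMA N:{Suc n..bnd \<rho> n'}. cov \<rho> n' N (map B [0..<Suc n] ! n'))
        = (SIGMA n':{..n}. SIGMA N:{Suc n..bnd \<rho> n'}. cov \<rho> n' N (B n'))"
        by (intro Sigma_cong refl) (auto simp del: upt_Suc simp: nth_map)
      then show ?thesis
        unfolding \<Phi>_def Let_def hist0 meas0 by simp
    qed
    have avoid: "Z \<rho> n' N \<inter> {y n..z n} = {}" if "N \<le> n" for n' N n
    proof (rule avoid_all[where y = y and z = z and Z = "Z \<rho>" and C = "\<lambda>n N. cov \<rho> n N (B n)"
             and bnd = "bnd \<rho>" and \<rho> = \<rho> and r = "\<beta>/2"])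
      show "y n \<le> y (Suc n)" "z (Suc n) \<le> z n" for n by (fact mono)+
    next
      fix n
      assume small: "\<And>n' N p. n' \<le> n \<Longrightarrow> p \<in> cov \<rho> n' N (B n') \<Longrightarrow> 2 * (snd p - fst p) < \<rho> * (\<beta>/2) ^ N"
      let ?m = "(y n + z n) / 2"
      have reply_eq: "reply \<sigma> B n =
          (if \<Phi> (map B [0..<Suc n]) (y n) ?m \<le> \<Phi> (map B [0..<Suc n]) (y n) (z n) / 2
           then {y n..?m} else {?m..z n})"
        by (simp only: reply_def \<sigma>_def Let_def last_hist y_def z_def)
      have half: "\<Phi> (map B [0..<Suc n]) u v \<le> \<Phi> (map B [0..<Suc n]) (y n) (z n) / 2"
        if "reply \<sigma> B n = {u..v}" "u < v" for u v
      proof (cases "\<Phi> (map B [0..<Suc n]) (y n) ?m \<le> \<Phi> (map B [0..<Suc n]) (y n) (z n) / 2")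
        case True
        then have "{u..v} = {y n..?m}"
          using that(1) by (simp only: reply_eq if_True if_False)
        then have "u = y n" "v = ?m" using that(2) unfolding Icc_eq_Icc by linarith+
        then show ?thesis using True by (simp only:)
      next
        case False
        then have "{u..v} = {?m..z n}"
          using that(1) by (simp only: reply_eq if_True if_False)
        then have "u = ?m" "v = z n" using that(2) unfolding Icc_eq_Icc by linarith+
        moreover have "\<Phi> (map B [0..<Suc n]) ?m (z n) \<le> \<Phi> (map B [0..<Suc n]) (y n) (z n) / 2"
          unfolding Phi_eq
        proof (rule touch_weight_sum_halves)
          fix t assume t: "t \<in> (SIGMA n':{..n}. SIGMA N:{Suc n..bnd \<rho> n'}. cov \<rho> n' N (B n'))"
          have "2 * (snd (snd (snd t)) - fst (snd (snd t))) < \<rho> * (\<beta>/2) ^ (fst (snd t))"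
            using t by (intro small[of "fst t"]) auto
          also have "\<dots> \<le> \<rho> * (\<beta>/2) ^ n"
            using t rho assms(1,2) by (intro mult_left_mono power_decreasing) auto
          finally show "2 * (snd (snd (snd t)) - fst (snd (snd t))) < z n - y n"
            by (simp add: len)
        qed (use False in \<open>auto simp: Phi_eq simp del: upt_Suc\<close>)
        ultimately show ?thesis by (simp only:)
      qed
      have "closed_interval (reply \<sigma> B n)"
        using amove[of n] by (simp add: legal_move_def)
      then obtain u v where uv: "u < v" "reply \<sigma> B n = {u..v}"
        by (rule closed_intervalE)
      have "B (Suc n) \<subseteq> reply \<sigma> B n" using move[of n] by (simp add: legal_move_def)
      then have "u \<le> y (Suc n)" "z (Suc n) \<le> v"
        using yz[of "Suc n"] by (auto simp: uv B_eq)
      then have "\<Phi> (map B [0..<Suc n]) (y (Suc n)) (z (Suc n)) \<le> \<Phi> (map B [0..<Suc n]) u v"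
        unfolding Phi_eq by (intro sum_mono mult_left_mono touch_weight_mono) auto
      with half[OF uv(2,1)]
      have "\<Phi> (map B [0..<Suc n]) (y (Suc n)) (z (Suc n)) \<le> \<Phi> (map B [0..<Suc n]) (y n) (z n) / 2"
        by linarith
      then show "(\<Sum>t\<in>(SIGMA n':{..n}. SIGMA N:{Suc n..bnd \<rho> n'}. cov \<rho> n' N (B n')).
           (2/3) ^ (fst (snd t) - n) * touch_weight (snd (snd t)) (y (Suc n)) (z (Suc n)))
         \<le> (\<Sum>t\<in>(SIGMA n':{..n}. SIGMA N:{Suc n..bnd \<rho> n'}. cov \<rho> n' N (B n')).
           (2/3) ^ (fst (snd t) - n) * touch_weight (snd (snd t)) (y n) (z n)) / 2"
        by (simp only: Phi_eq)
    next
      fix n N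
      assume "\<And>n' N. N \<le> n \<Longrightarrow> Z \<rho> n' N \<inter> {y n..z n} = {}"
      then have ex: "\<exists>\<J>. covering (Z \<rho> n N \<inter> B n) (\<rho> * (\<beta>/2) ^ N) \<J>"
        using sch sub[of n] unfolding B_eq len by blast
      show "covering (Z \<rho> n N \<inter> {y n..z n}) (\<rho> * (\<beta>/2) ^ N) (cov \<rho> n N (B n)) \<and>
          (N < n + 14 \<longrightarrow> cov \<rho> n N (B n) = {})"
      proof (cases "N < n + 14")
        case True
        then have "Z \<rho> n N = {}" using sch by (metis not_le)
        then show ?thesis using True by (simp add: cov_def covering_empty)
      next
        case False
        then show ?thesis using someI_ex[OF ex] by (simp add: cov_def B_eq)
      qed
    next
      show "n + 14 \<le> N \<and> N \<le> bnd \<rho> n" if "Z \<rho> n N \<noteq> {}" for n N using sch that by blast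
    qed (fact that)
    have "(\<lambda>n. - (\<rho> * (\<beta>/2) ^ n)) \<longlonglongrightarrow> 0"
      using assms(1,2) by (auto intro!: tendsto_eq_intros LIMSEQ_realpow_zero)
    then have lim: "(\<lambda>n. y n - z n) \<longlonglongrightarrow> 0"
      by (simp add: len)
    obtain l where l: "\<And>n. y n \<le> l" "\<And>n. l \<le> z n" "y \<longlonglongrightarrow> l" "z \<longlonglongrightarrow> l"
      using nested_sequence_unique[of y z] mono yz lim less_imp_le by metis
    have "x = l" if "\<And>n. x \<in> {y n..z n}" for x
      using that LIMSEQ_le_const[OF l(4), of x] LIMSEQ_le_const2[OF l(3), of x]
      by (auto intro!: antisym)
    then have "\<exists>x. (\<Inter>n. B n) = {x}"
      using l(1,2) unfolding B_eq by (intro exI[of _ l]) auto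
    then obtain x where x: "(\<Inter>n. B n) = {x}" by blast
    then have xB: "x \<in> B n" for n by blast
    have "x \<notin> Z \<rho> n N" for n N
      using avoid[of N N n] xB[of N] B_eq[of N] by auto
    then have "x \<in> X" using xB[of 0] sub[of 0] by (intro target[OF rho]) auto
    with x show ?thesis by blast
  qed
  moreover have "legal_move (1/2) (B n) (reply \<sigma> B n)" if "B_legal_upto \<beta> {a..b} \<sigma> B n" for B n
    unfolding reply_def by (rule legal[OF closed[OF that] last_hist[of B n]])
  ultimately show ?thesis
    using assms(3) unfolding game_winning_def winning_strategy_def by blast
qed

subsection \<open>Strips around rational lines\<close>

lemma components_Un_le_2:
  fixes S T :: "'a::topological_space set"
  assumes "connected S" "connected T"
  shows "finite (components (S \<union> T))" "card (components (S \<union> T)) \<le> 2"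
proof -
  let ?c = "connected_component_set (S \<union> T)"
  have "?c x = ?c (SOME s. s \<in> S)" if "x \<in> S" for x
    using that assms(1) someI[of "\<lambda>s. s \<in> S" x]
    by (intro connected_component_eq) (auto simp: connected_component_def)
  moreover have "?c x = ?c (SOME t. t \<in> T)" if "x \<in> T" for x
    using that assms(2) someI[of "\<lambda>t. t \<in> T" x]
    by (intro connected_component_eq) (auto simp: connected_component_def)
  ultimately have sub: "components (S \<union> T) \<subseteq> {?c (SOME s. s \<in> S), ?c (SOME t. t \<in> T)}"
    unfolding components_def by blast
  then show "finite (components (S \<union> T))" by (rule finite_subset) simp
  have "card (components (S \<union> T)) \<le> card {?c (SOME s. s \<in> S), ?c (SOME t. t \<in> T)}"
    using sub by (intro card_mono) auto
  also have "\<dots> \<le> 2" by (simp add: card_insert_if)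
  finally show "card (components (S \<union> T)) \<le> 2" .
qed

text \<open>For quasiconvex \<open>G\<close> both {G \<le> h} and {G < -h} are intervals, and
  removing the second from the first leaves at most one piece on each side. \<open>S\<close> is the
  piece to the left of the gap, or all of \<open>D\<close> if there is no gap, and \<open>T\<close>
  the piece to its right.\<close>

lemma quasiconvex_strip_components:
  fixes G :: "real \<Rightarrow> real" and a b h :: real
  assumes qc: "\<And>x y z. x \<in> {a..b} \<Longrightarrow> z \<in> {a..b} \<Longrightarrow> x < y \<Longrightarrow> y < z \<Longrightarrow> G y \<le> max (G x) (G z)"
  defines "D \<equiv> {x\<in>{a..b}. \<bar>G x\<bar> \<le> h}"
  shows "finite (components D)" "card (components D) \<le> 2"
proof -
  define S where "S = {x\<in>D. \<forall>g\<in>{a..b}. G g < - h \<longrightarrow> x < g}"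
  define T where "T = {x\<in>D. \<exists>g\<in>{a..b}. G g < - h \<and> g < x}"
  have D: "x \<in> {a..b}" "G x \<le> h" "- h \<le> G x" if "x \<in> D" for x
    using that by (auto simp: D_def)
  have D_between: "y \<in> {a..b}" "G y \<le> h" if "x \<in> D" "z \<in> D" "x \<le> y" "y \<le> z" for x y z
  proof -
    show "y \<in> {a..b}" using D(1)[of x] D(1)[of z] that by simp
    show "G y \<le> h"
    proof (cases "x = y \<or> y = z")
      case False
      then have "G y \<le> max (G x) (G z)" using that D(1) by (intro qc) auto
      then show ?thesis using D(2)[OF that(1)] D(2)[OF that(2)] by linarith
    qed (use D that in auto)
  qed
  have D_intro: "y \<in> D" if "y \<in> {a..b}" "G y \<le> h" "- h \<le> G y" for y
    using that by (simp add: D_def abs_le_iff)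
  have "D \<subseteq> S \<union> T"
  proof
    fix x assume x: "x \<in> D"
    then have "x < g" if "G g < - h" "\<not> g < x" for g
      using D(3)[OF x] that by (cases x g rule: linorder_cases) auto
    then show "x \<in> S \<union> T" using x unfolding S_def T_def by blast
  qed
  then have "D = S \<union> T" by (auto simp: S_def T_def)
  moreover have "connected S"
  proof (rule is_interval_connected, unfold is_interval_1, intro ballI allI impI)
    fix x z y assume xz: "x \<in> S" "z \<in> S" and xyz: "x \<le> y \<and> y \<le> z"
    then have D': "x \<in> D" "z \<in> D" by (simp_all add: S_def)
    note y = D_between[OF D' conjunct1[OF xyz] conjunct2[OF xyz]]
    have lt: "y < g" if "g \<in> {a..b}" "G g < -h" for g
    proof -
      have "z < g" using xz(2) that by (simp add: S_def)
      then show ?thesis using xyz by linarith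
    qed
    have "- h \<le> G y" using lt[OF y(1)] by (meson less_irrefl not_le)
    then show "y \<in> S" using lt D_intro[OF y] unfolding S_def by blast
  qed
  moreover have "connected T"
  proof (rule is_interval_connected, unfold is_interval_1, intro ballI allI impI)
    fix x z y assume xz: "x \<in> T" "z \<in> T" and xyz: "x \<le> y \<and> y \<le> z"
    then have D': "x \<in> D" "z \<in> D" by (simp_all add: T_def)
    note y = D_between[OF D' conjunct1[OF xyz] conjunct2[OF xyz]]
    obtain g where g: "g \<in> {a..b}" "G g < -h" "g < x" using xz(1) unfolding T_def by blast
    have "- h \<le> G y"
    proof (rule ccontr)
      assume c: "\<not> - h \<le> G y"
      then have "x \<noteq> y" using D(3)[OF D'(1)] by auto
      then have "G x \<le> max (G g) (G y)" using g y(1) xyz by (intro qc) auto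
      then show False using c g(2) D(3)[OF D'(1)] by linarith
    qed
    moreover have "g < y" using g(3) xyz by linarith
    ultimately show "y \<in> T" using g(1,2) D_intro[OF y] unfolding T_def by blast
  qed
  ultimately show "finite (components D)" "card (components D) \<le> 2"
    using components_Un_le_2[of S T] by simp_all
qed

section \<open>Quantitative calculus on a curve of nonvanishing curvature\<close>

locale planar_curve =
  fixes i j a b K :: real and f f' f'' :: "real \<Rightarrow> real"
  assumes j_pos: "0 < j" and j_le_i: "j \<le> i" and i_less_1: "i < 1" and i_plus_j: "i + j = 1"
    and K_ge_1: "1 \<le> K"
    and f_deriv: "\<And>x. x \<in> {a..b} \<Longrightarrow> (f has_real_derivative f' x) (at x within {a..b})"
    and f'_deriv: "\<And>x. x \<in> {a..b} \<Longrightarrow> (f' has_real_derivative f'' x) (at x within {a..b})"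
    and f'_le: "\<And>x. x \<in> {a..b} \<Longrightarrow> \<bar>f' x\<bar> \<le> K"
    and f''_le: "\<And>x. x \<in> {a..b} \<Longrightarrow> \<bar>f'' x\<bar> \<le> K"
    and f''_sign: "(\<forall>x\<in>{a..b}. 1 / K \<le> f'' x) \<or> (\<forall>x\<in>{a..b}. f'' x \<le> - (1 / K))"
begin

lemma i_ge_half: "1/2 \<le> i" and i_pos: "0 < i" and j_less_1: "j < 1"
  using j_pos j_le_i i_plus_j by auto

lemma f_mvt:
  assumes "x \<in> {a..b}" "y \<in> {a..b}" "x < y"
  shows "\<exists>\<xi>. x < \<xi> \<and> \<xi> < y \<and> f y - f x = (y - x) * f' \<xi>"
proof -
  have "(f has_derivative (\<lambda>h. f' t * h)) (at t within {x..y})" if "x \<le> t" "t \<le> y" for t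
    using f_deriv[of t] that assms
    by (auto simp: has_field_derivative_def mult_commute_abs intro: has_derivative_subset)
  from mvt_simple[OF assms(3) this] show ?thesis by (auto simp: mult.commute)
qed

lemma f'_mvt:
  assumes "x \<in> {a..b}" "y \<in> {a..b}" "x < y"
  shows "\<exists>\<xi>. x < \<xi> \<and> \<xi> < y \<and> f' y - f' x = (y - x) * f'' \<xi>"
proof -
  have "(f' has_derivative (\<lambda>h. f'' t * h)) (at t within {x..y})" if "x \<le> t" "t \<le> y" for t
    using f'_deriv[of t] that assms
    by (auto simp: has_field_derivative_def mult_commute_abs intro: has_derivative_subset)
  from mvt_simple[OF assms(3) this] show ?thesis by (auto simp: mult.commute)
qed

lemma f'_lipschitz:
  assumes "x \<in> {a..b}" "y \<in> {a..b}"
  shows "\<bar>f' y - f' x\<bar> \<le> K * \<bar>y - x\<bar>"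
proof -
  have *: "\<bar>f' v - f' u\<bar> \<le> K * \<bar>v - u\<bar>" if uv: "u \<in> {a..b}" "v \<in> {a..b}" "u < v" for u v
  proof -
    obtain \<xi> where \<xi>: "u < \<xi>" "\<xi> < v" "f' v - f' u = (v - u) * f'' \<xi>" using f'_mvt[OF uv] by blast
    then have "\<bar>f'' \<xi>\<bar> \<le> K" using uv by (intro f''_le) auto
    then have "\<bar>v - u\<bar> * \<bar>f'' \<xi>\<bar> \<le> \<bar>v - u\<bar> * K" by (intro mult_left_mono) auto
    then show ?thesis unfolding \<xi>(3) abs_mult by (simp add: mult.commute)
  qed
  show ?thesis
    using *[of x y] *[of y x] assms by (cases x y rule: linorder_cases) (auto simp: abs_minus_commute)
qed

lemma f_taylor:
  assumes "x \<in> {a..b}" "y \<in> {a..b}"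
  shows "\<bar>f y - f x - f' x * (y - x)\<bar> \<le> K * (y - x)^2"
proof -
  have "\<exists>\<xi>. \<bar>\<xi> - x\<bar> \<le> \<bar>y - x\<bar> \<and> \<xi> \<in> {a..b} \<and> f y - f x = (y - x) * f' \<xi>"
  proof (cases x y rule: linorder_cases)
    case less
    then obtain \<xi> where "x < \<xi>" "\<xi> < y" "f y - f x = (y - x) * f' \<xi>"
      using f_mvt[OF assms] by blast
    with assms show ?thesis by (intro exI[of _ \<xi>]) auto
  next
    case greater
    then obtain \<xi> where "y < \<xi>" "\<xi> < x" "f x - f y = (x - y) * f' \<xi>"
      using f_mvt[OF assms(2,1)] by blast
    with assms show ?thesis by (intro exI[of _ \<xi>]) (auto simp: algebra_simps)
  qed (use assms in auto)
  then obtain \<xi> where \<xi>: "\<bar>\<xi> - x\<bar> \<le> \<bar>y - x\<bar>" "\<xi> \<in> {a..b}" "f y - f x = (y - x) * f' \<xi>" by blast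
  have "f y - f x - f' x * (y - x) = (y - x) * (f' \<xi> - f' x)"
    using \<xi>(3) by (simp add: algebra_simps)
  also have "\<bar>\<dots>\<bar> \<le> \<bar>y - x\<bar> * (K * \<bar>y - x\<bar>)"
    unfolding abs_mult using f'_lipschitz[OF assms(1) \<xi>(2)] \<xi>(1) K_ge_1
    by (intro mult_left_mono) (auto intro: order_trans mult_left_mono)
  finally show ?thesis by (simp add: power2_eq_square mult_ac flip: abs_mult)
qed

text \<open>Curvature in the form in which it is used: f' separates points, so a slope with nonzero
  \<open>B\<close> cannot stay small along a long interval.\<close>

lemma f'_expanding:
  assumes "x \<in> {a..b}" "y \<in> {a..b}"
  shows "\<bar>y - x\<bar> \<le> K * \<bar>f' y - f' x\<bar>"
proof -
  have *: "\<bar>v - u\<bar> \<le> K * \<bar>f' v - f' u\<bar>" if uv: "u \<in> {a..b}" "v \<in> {a..b}" "u < v" for u v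
  proof -
    obtain \<xi> where \<xi>: "u < \<xi>" "\<xi> < v" "f' v - f' u = (v - u) * f'' \<xi>" using f'_mvt[OF uv] by blast
    then have "\<xi> \<in> {a..b}" using uv by auto
    then have "1 / K \<le> f'' \<xi> \<or> f'' \<xi> \<le> - (1 / K)" using f''_sign by blast
    then have "1 / K \<le> \<bar>f'' \<xi>\<bar>" by linarith
    then have "1 \<le> K * \<bar>f'' \<xi>\<bar>" using K_ge_1 by (simp add: field_simps)
    then have "\<bar>v - u\<bar> * 1 \<le> \<bar>v - u\<bar> * (K * \<bar>f'' \<xi>\<bar>)" by (intro mult_left_mono) auto
    then show ?thesis unfolding \<xi>(3) abs_mult by (simp add: mult_ac)
  qed
  show ?thesis
    using *[of x y] *[of y x] assms by (cases x y rule: linorder_cases) (auto simp: abs_minus_commute)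
qed

section \<open>Linear forms along the curve and their strips\<close>

definition line_form :: "int \<Rightarrow> int \<Rightarrow> int \<Rightarrow> real \<Rightarrow> real" where
  "line_form A B C x = of_int A * x - of_int B * f x + of_int C"

text \<open>The derivative of \<open>line_form A B C\<close> along the curve.\<close>

definition slope :: "int \<Rightarrow> int \<Rightarrow> real \<Rightarrow> real" where
  "slope A B x = of_int A - of_int B * f' x"

definition strip :: "int \<Rightarrow> int \<Rightarrow> int \<Rightarrow> real \<Rightarrow> real set" where
  "strip A B C h = {x\<in>{a..b}. \<bar>line_form A B C x\<bar> \<le> h}"

lemma strip_uminus: "strip (-A) (-B) (-C) h = strip A B C h"
proof -
  have "line_form (-A) (-B) (-C) x = - line_form A B C x" for x
    by (simp add: line_form_def)
  then show ?thesis by (simp add: strip_def)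
qed

lemma line_form_mvt:
  assumes "x \<in> {a..b}" "y \<in> {a..b}" "x < y"
  shows "\<exists>\<xi>. x < \<xi> \<and> \<xi> < y \<and> line_form A B C y - line_form A B C x = (y - x) * slope A B \<xi>"
proof -
  obtain \<xi> where \<xi>: "x < \<xi>" "\<xi> < y" "f y - f x = (y - x) * f' \<xi>" using f_mvt[OF assms] by blast
  have "line_form A B C y - line_form A B C x = of_int A * (y - x) - of_int B * (f y - f x)"
    by (simp add: line_form_def algebra_simps)
  also have "\<dots> = (y - x) * slope A B \<xi>"
    unfolding \<xi>(3) by (simp add: slope_def algebra_simps)
  finally show ?thesis using \<xi> by blast
qed

lemma slope_diff: "slope A B y - slope A B x = - (of_int B * (f' y - f' x))"
  by (simp add: slope_def algebra_simps)

lemma slope_lipschitz: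
  assumes "x \<in> {a..b}" "y \<in> {a..b}"
  shows "\<bar>slope A B y - slope A B x\<bar> \<le> \<bar>of_int B\<bar> * (K * \<bar>y - x\<bar>)"
  unfolding slope_diff abs_minus_cancel abs_mult using f'_lipschitz[OF assms]
  by (intro mult_left_mono) auto

lemma line_form_continuous: "continuous_on {a..b} (line_form A B C)"
proof -
  have "continuous_on {a..b} f"
    using f_deriv by (intro DERIV_continuous_on) auto
  then show ?thesis unfolding line_form_def[abs_def] by (intro continuous_intros)
qed

lemma strip_compact: "compact (strip A B C h)"
proof -
  have "strip A B C h = {a..b} \<inter> line_form A B C -` {-h..h}"
    by (auto simp: strip_def abs_le_iff)
  also have "closed \<dots>"
    by (intro continuous_closed_preimage line_form_continuous) auto
  finally have "closed (strip A B C h)" .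
  moreover have "bounded (strip A B C h)"
    by (rule bounded_subset[of "{a..b}"]) (auto simp: strip_def)
  ultimately show ?thesis by (simp add: compact_eq_bounded_closed)
qed

lemma strip_component_interval:
  assumes "S \<in> components (strip A B C h)"
  obtains u w where "u \<le> w" "S = {u..w}"
proof -
  have "compact S" using assms strip_compact by (rule compact_components[rotated])
  moreover have "connected S" using assms by (rule in_components_connected)
  ultimately obtain u w where "S = {u..w}" using connected_compact_interval_1[of S] by auto
  moreover have "S \<noteq> {}" using assms by (rule in_components_nonempty)
  ultimately show thesis using that[of u w] by auto
qed

text \<open>If the form at y exceeded both end values, its slope would be positive somewhere before
  y and negative somewhere after it.\<close>

lemma slope_quasiconvex:
  assumes mono: "\<And>x y. x \<in> {a..b} \<Longrightarrow> y \<in> {a..b} \<Longrightarrow> x < y \<Longrightarrow> slope A B x \<le> slope A B y"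
    and "x \<in> {a..b}" "z \<in> {a..b}" "x < y" "y < z"
  shows "line_form A B C y \<le> max (line_form A B C x) (line_form A B C z)"
proof (rule ccontr)
  assume c: "\<not> ?thesis"
  have y: "y \<in> {a..b}" using assms by auto
  obtain \<xi> where \<xi>: "x < \<xi>" "\<xi> < y" "line_form A B C y - line_form A B C x = (y - x) * slope A B \<xi>"
    using line_form_mvt[OF assms(2) y assms(4)] by blast
  obtain \<eta> where \<eta>: "y < \<eta>" "\<eta> < z" "line_form A B C z - line_form A B C y = (z - y) * slope A B \<eta>"
    using line_form_mvt[OF y assms(3,5)] by blast
  have "0 < (y - x) * slope A B \<xi>" using c \<xi>(3) by linarith
  then have "0 < slope A B \<xi>" using assms(4) by (simp add: zero_less_mult_iff)
  moreover have "(z - y) * slope A B \<eta> < 0" using c \<eta>(3) by linarith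
  then have "slope A B \<eta> < 0" using assms(5) by (simp add: mult_less_0_iff)
  moreover have "slope A B \<xi> \<le> slope A B \<eta>"
    using \<xi> \<eta> assms by (intro mono) auto
  ultimately show False by simp
qed

lemma strip_components:
  shows "finite (components (strip A B C h))" "card (components (strip A B C h)) \<le> 2"
proof -
  have f'_mono: "(\<forall>x\<in>{a..b}. \<forall>y\<in>{a..b}. x < y \<longrightarrow> f' x \<le> f' y) \<or>
      (\<forall>x\<in>{a..b}. \<forall>y\<in>{a..b}. x < y \<longrightarrow> f' y \<le> f' x)"
    using f''_sign
  proof
    assume pos: "\<forall>x\<in>{a..b}. 1 / K \<le> f'' x"
    have "f' x \<le> f' y" if xy: "x \<in> {a..b}" "y \<in> {a..b}" "x < y" for x y
    proof -
      obtain \<xi> where \<xi>: "x < \<xi>" "\<xi> < y" "f' y - f' x = (y - x) * f'' \<xi>" using f'_mvt[OF xy] by blast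
      have "1 / K \<le> f'' \<xi>" using pos \<xi> xy by auto
      moreover have "0 < 1 / K" using K_ge_1 by simp
      ultimately have "0 \<le> (y - x) * f'' \<xi>" using xy by (intro mult_nonneg_nonneg) linarith+
      then show ?thesis using \<xi>(3) by simp
    qed
    then show ?thesis by blast
  next
    assume neg: "\<forall>x\<in>{a..b}. f'' x \<le> - (1 / K)"
    have "f' y \<le> f' x" if xy: "x \<in> {a..b}" "y \<in> {a..b}" "x < y" for x y
    proof -
      obtain \<xi> where \<xi>: "x < \<xi>" "\<xi> < y" "f' y - f' x = (y - x) * f'' \<xi>" using f'_mvt[OF xy] by blast
      have "f'' \<xi> \<le> - (1 / K)" using neg \<xi> xy by auto
      moreover have "0 < 1 / K" using K_ge_1 by simp
      ultimately have "(y - x) * f'' \<xi> \<le> 0" using xy by (intro mult_nonneg_nonpos) linarith+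
      then show ?thesis using \<xi>(3) by simp
    qed
    then show ?thesis by blast
  qed
  \<comment> \<open>Reversing all three signs keeps the strip, so the slope may be taken to be
    nondecreasing.\<close>
  have "(\<forall>x\<in>{a..b}. \<forall>y\<in>{a..b}. x < y \<longrightarrow> slope A B x \<le> slope A B y) \<or>
      (\<forall>x\<in>{a..b}. \<forall>y\<in>{a..b}. x < y \<longrightarrow> slope (-A) (-B) x \<le> slope (-A) (-B) y)"
    using f'_mono
    by (cases "0 \<le> B") (auto simp: slope_def mult_left_mono mult_left_mono_neg)
  then obtain A' B' C' where s: "strip A B C h = strip A' B' C' h"
      "\<And>x y. x \<in> {a..b} \<Longrightarrow> y \<in> {a..b} \<Longrightarrow> x < y \<Longrightarrow> slope A' B' x \<le> slope A' B' y"
    using strip_uminus by metis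
  have q: "line_form A' B' C' y \<le> max (line_form A' B' C' x) (line_form A' B' C' z)"
    if "x \<in> {a..b}" "z \<in> {a..b}" "x < y" "y < z" for x y z
    using s(2) that by (rule slope_quasiconvex)
  have "strip A B C h = {x\<in>{a..b}. \<bar>line_form A' B' C' x\<bar> \<le> h}"
    unfolding s(1) by (simp only: strip_def)
  then show "finite (components (strip A B C h))" "card (components (strip A B C h)) \<le> 2"
    using quasiconvex_strip_components[of a b "line_form A' B' C'" h] q by simp_all
qed

text \<open>Across each outer third, of length d, the form changes by at most 2h, so there are
  points \<xi> and \<eta> in these thirds with slope at most 2h/d. They are at least d apart, so by
  \<open>f'_expanding\<close> their slopes differ by at least |B| d / K, which bounds |B|. The
  Lipschitz bound then carries the slope estimate to any x.\<close>

lemma strip_interval_bounds: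
  assumes uw: "{u..w} \<subseteq> strip A B C h" "u < w" and x: "x \<in> {u..w}"
  shows "\<bar>of_int B\<bar> * (w - u)^2 \<le> 36 * K * h" "\<bar>slope A B x\<bar> * (w - u) \<le> 42 * K^2 * h"
proof -
  define d where "d = (w - u) / 3"
  have d: "0 < d" "w = u + 3 * d" using uw by (auto simp: d_def field_simps)
  have I: "t \<in> {a..b}" "\<bar>line_form A B C t\<bar> \<le> h" if "t \<in> {u..w}" for t
    using that uw by (auto simp: strip_def)
  obtain \<xi> where \<xi>: "u < \<xi>" "\<xi> < u + d" "line_form A B C (u + d) - line_form A B C u = d * slope A B \<xi>"
    using line_form_mvt[of u "u + d"] I d by force
  obtain \<eta> where \<eta>: "u + 2 * d < \<eta>" "\<eta> < w" "line_form A B C w - line_form A B C (u + 2 * d) = d * slope A B \<eta>"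
    using line_form_mvt[of "u + 2 * d" w] I d by force
  have "\<bar>d * slope A B \<xi>\<bar> \<le> 2 * h"
    unfolding \<xi>(3)[symmetric] using I(2)[of u] I(2)[of "u + d"] d by auto
  then have s1: "d * \<bar>slope A B \<xi>\<bar> \<le> 2 * h" using d by (simp add: abs_mult)
  have "\<bar>d * slope A B \<eta>\<bar> \<le> 2 * h"
    unfolding \<eta>(3)[symmetric] using I(2)[of w] I(2)[of "u + 2 * d"] d by auto
  then have s2: "d * \<bar>slope A B \<eta>\<bar> \<le> 2 * h" using d by (simp add: abs_mult)
  have "\<bar>of_int B\<bar> * d \<le> \<bar>of_int B\<bar> * (K * \<bar>f' \<eta> - f' \<xi>\<bar>)"
    using f'_expanding[of \<xi> \<eta>] I(1)[of \<xi>] I(1)[of \<eta>] \<xi> \<eta> d by (intro mult_left_mono) auto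
  also have "\<dots> = K * \<bar>slope A B \<eta> - slope A B \<xi>\<bar>"
    by (simp add: slope_diff abs_mult mult_ac)
  also have "\<dots> \<le> K * (\<bar>slope A B \<eta>\<bar> + \<bar>slope A B \<xi>\<bar>)"
    using K_ge_1 by (intro mult_left_mono) auto
  finally have "d * (\<bar>of_int B\<bar> * d) \<le> d * (K * (\<bar>slope A B \<eta>\<bar> + \<bar>slope A B \<xi>\<bar>))"
    using d by (intro mult_left_mono) auto
  also have "\<dots> = K * (d * \<bar>slope A B \<eta>\<bar> + d * \<bar>slope A B \<xi>\<bar>)" by (simp add: algebra_simps)
  also have "\<dots> \<le> K * (4 * h)" using s1 s2 K_ge_1 by (intro mult_left_mono) auto
  finally have Bd: "\<bar>of_int B\<bar> * d^2 \<le> 4 * K * h" by (simp add: power2_eq_square mult_ac)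
  show "\<bar>of_int B\<bar> * (w - u)^2 \<le> 36 * K * h"
    using Bd d by (simp add: power_mult_distrib)
  have "\<bar>slope A B x\<bar> \<le> \<bar>slope A B \<xi>\<bar> + \<bar>slope A B x - slope A B \<xi>\<bar>" by simp
  also have "\<dots> \<le> \<bar>slope A B \<xi>\<bar> + \<bar>of_int B\<bar> * (K * \<bar>x - \<xi>\<bar>)"
    using slope_lipschitz[of \<xi> x A B] I(1)[of \<xi>] I(1)[of x] x \<xi> d by auto
  also have "\<dots> \<le> \<bar>slope A B \<xi>\<bar> + \<bar>of_int B\<bar> * (K * (3 * d))"
    using K_ge_1 x \<xi> d by (intro add_left_mono mult_left_mono) auto
  finally have "(3 * d) * \<bar>slope A B x\<bar> \<le> (3 * d) * (\<bar>slope A B \<xi>\<bar> + \<bar>of_int B\<bar> * (K * (3 * d)))"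
    using d by (intro mult_left_mono) auto
  also have "\<dots> = 3 * (d * \<bar>slope A B \<xi>\<bar>) + 9 * K * (\<bar>of_int B\<bar> * d^2)"
    by (simp add: algebra_simps power2_eq_square)
  also have "\<dots> \<le> 3 * (2 * h) + 9 * K * (4 * K * h)"
    using s1 Bd K_ge_1 by (intro add_mono mult_left_mono) auto
  also have "\<dots> \<le> 42 * K^2 * h"
  proof -
    have "0 \<le> h" using I(2)[of u] uw(2) by force
    moreover have "1 \<le> K^2" using K_ge_1 by simp
    ultimately have "1 * h \<le> K^2 * h" by (intro mult_right_mono) auto
    then show ?thesis by (simp add: power2_eq_square)
  qed
  finally show "\<bar>slope A B x\<bar> * (w - u) \<le> 42 * K^2 * h"
    using d by (simp add: mult_ac)
qed

text \<open>Carries the estimates from a component over to a longer interval that meets it at t: the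
  slope by the Lipschitz bound (78 = 42 + 36), then the form by a mean value between t and x (79 =
  78 + 1).\<close>

lemma strip_ball_bounds:
  assumes uw: "{u..w} \<subseteq> strip A B C h" "u < w" "w - u \<le> l" and ball: "{y..y+l} \<subseteq> {a..b}"
    and t: "t \<in> {u..w}" "t \<in> {y..y+l}" and x: "x \<in> {y..y+l}"
  shows "\<bar>slope A B x\<bar> * (w - u)^2 \<le> 78 * K^2 * h * l"
    and "\<bar>line_form A B C x\<bar> * (w - u)^2 \<le> 79 * K^2 * h * l^2"
proof -
  define d where "d = w - u"
  have d: "0 < d" "d \<le> l" using uw by (auto simp: d_def)
  have h: "0 \<le> h" "\<bar>line_form A B C t\<bar> \<le> h" using uw(1) t(1) by (force simp: strip_def)+
  note bnd = strip_interval_bounds[OF uw(1,2) t(1), folded d_def]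
  have S: "\<bar>slope A B z\<bar> * d^2 \<le> 78 * K^2 * h * l" if z: "z \<in> {y..y+l}" for z
  proof -
    have tz: "t \<in> {a..b}" "z \<in> {a..b}" "\<bar>z - t\<bar> \<le> l" using ball t z by auto
    have "\<bar>slope A B z\<bar> \<le> \<bar>slope A B t\<bar> + \<bar>slope A B z - slope A B t\<bar>" by simp
    also have "\<dots> \<le> \<bar>slope A B t\<bar> + \<bar>of_int B\<bar> * (K * \<bar>z - t\<bar>)"
      using slope_lipschitz[OF tz(1,2)] by (intro add_left_mono)
    also have "\<dots> \<le> \<bar>slope A B t\<bar> + \<bar>of_int B\<bar> * (K * l)"
      using tz K_ge_1 by (intro add_left_mono mult_left_mono) auto
    finally have "\<bar>slope A B z\<bar> * d^2 \<le> (\<bar>slope A B t\<bar> + \<bar>of_int B\<bar> * (K * l)) * d^2"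
      by (intro mult_right_mono) auto
    also have "\<dots> = \<bar>slope A B t\<bar> * d * d + \<bar>of_int B\<bar> * d^2 * (K * l)"
      by (simp add: algebra_simps power2_eq_square)
    also have "\<dots> \<le> 42 * K^2 * h * l + 36 * K * h * (K * l)"
    proof (intro add_mono)
      show "\<bar>slope A B t\<bar> * d * d \<le> 42 * K^2 * h * l"
        by (rule mult_mono[OF bnd(2)]) (use d h in auto)
      show "\<bar>of_int B\<bar> * d^2 * (K * l) \<le> 36 * K * h * (K * l)"
        by (rule mult_right_mono[OF bnd(1)]) (use d K_ge_1 in auto)
    qed
    finally show ?thesis by (simp add: power2_eq_square mult_ac)
  qed
  show "\<bar>slope A B x\<bar> * (w - u)^2 \<le> 78 * K^2 * h * l" using S[OF x] by (simp add: d_def)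
  have "\<exists>\<xi>\<in>{y..y+l}. \<bar>line_form A B C x - line_form A B C t\<bar> = \<bar>x - t\<bar> * \<bar>slope A B \<xi>\<bar>"
  proof (cases x t rule: linorder_cases)
    case less
    then obtain \<xi> where "x < \<xi>" "\<xi> < t" "line_form A B C t - line_form A B C x = (t - x) * slope A B \<xi>"
      using line_form_mvt[of x t] x t ball by blast
    then show ?thesis using x t by (intro bexI[of _ \<xi>]) (auto simp: abs_mult abs_minus_commute)
  next
    case greater
    then obtain \<xi> where "t < \<xi>" "\<xi> < x" "line_form A B C x - line_form A B C t = (x - t) * slope A B \<xi>"
      using line_form_mvt[of t x] x t ball by blast
    then show ?thesis using x t by (intro bexI[of _ \<xi>]) (auto simp: abs_mult)
  qed (use x in auto)
  then obtain \<xi> where \<xi>: "\<xi> \<in> {y..y+l}"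
      "\<bar>line_form A B C x - line_form A B C t\<bar> = \<bar>x - t\<bar> * \<bar>slope A B \<xi>\<bar>" by blast
  have "\<bar>line_form A B C x\<bar> \<le> \<bar>line_form A B C t\<bar> + \<bar>line_form A B C x - line_form A B C t\<bar>" by simp
  also have "\<dots> \<le> h + l * \<bar>slope A B \<xi>\<bar>"
    unfolding \<xi>(2) using h x t by (intro add_mono mult_right_mono) auto
  finally have "\<bar>line_form A B C x\<bar> * d^2 \<le> (h + l * \<bar>slope A B \<xi>\<bar>) * d^2"
    by (intro mult_right_mono) auto
  also have "\<dots> = h * d^2 + l * (\<bar>slope A B \<xi>\<bar> * d^2)" by (simp add: algebra_simps)
  also have "\<dots> \<le> K^2 * h * l^2 + l * (78 * K^2 * h * l)"
  proof (intro add_mono mult_left_mono S \<xi>)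
    have "1 * h * d^2 \<le> K^2 * h * l^2"
      using h d K_ge_1 by (intro mult_mono power_mono) auto
    then show "h * d^2 \<le> K^2 * h * l^2" by simp
  qed (use d in auto)
  finally show "\<bar>line_form A B C x\<bar> * (w - u)^2 \<le> 79 * K^2 * h * l^2"
    by (simp add: d_def power2_eq_square mult_ac)
qed

text \<open>Cramer's rule for the common point (p/q, r/q) of two lines. The plain rule has the
  coefficients \<open>A1\<close>, \<open>A2\<close> where slopes appear here; with slopes, q and the
  vertical error are small when both slopes are, at the price of f' times the horizontal
  error.\<close>

lemma intersection_point:
  fixes A1 B1 C1 A2 B2 C2 :: int
  defines "q \<equiv> A1 * B2 - A2 * B1" and "p \<equiv> B1 * C2 - B2 * C1" and "r \<equiv> A1 * C2 - A2 * C1"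
  shows "of_int q = slope A1 B1 x * of_int B2 - slope A2 B2 x * of_int B1"
    and "of_int q * x - of_int p = of_int B2 * line_form A1 B1 C1 x - of_int B1 * line_form A2 B2 C2 x"
    and "of_int q * f x - of_int r = slope A2 B2 x * line_form A1 B1 C1 x - slope A1 B1 x * line_form A2 B2 C2 x
           + f' x * (of_int q * x - of_int p)"
  by (simp_all add: q_def p_def r_def slope_def line_form_def algebra_simps)

end

section \<open>Minors and proportional integer vectors\<close>

lemma abs_mult_diff_le:
  fixes x1 y1 x2 y2 X Y :: real
  assumes "\<bar>x1\<bar> \<le> X" "\<bar>y1\<bar> \<le> Y" "\<bar>x2\<bar> \<le> X" "\<bar>y2\<bar> \<le> Y"
  shows "\<bar>x1 * y2 - x2 * y1\<bar> \<le> 2 * X * Y"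
proof -
  have *: "\<bar>s * t\<bar> \<le> X * Y" if "\<bar>s\<bar> \<le> X" "\<bar>t\<bar> \<le> Y" for s t :: real
    unfolding abs_mult using that by (intro mult_mono) auto
  show ?thesis using *[OF assms(1,4)] *[OF assms(3,2)] by linarith
qed

text \<open>\<open>A2\<close> times the first vector is \<open>A1\<close> times the second; taking
  gcds gives |A1| = |A2|, and likewise for the other coordinates. The vanishing minors exclude mixed
  signs.\<close>

lemma primitive_parallel:
  fixes A1 B1 C1 A2 B2 C2 :: int
  assumes g: "gcd A1 (gcd B1 C1) = 1" "gcd A2 (gcd B2 C2) = 1"
    and eq: "A1 * B2 = A2 * B1" "A1 * C2 = A2 * C1" "B1 * C2 = B2 * C1"
  shows "(A2 = A1 \<and> B2 = B1 \<and> C2 = C1) \<or> (A2 = - A1 \<and> B2 = - B1 \<and> C2 = - C1)"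
proof -
  have gcd_mult: "gcd (x * A) (gcd (x * B) (x * C)) = \<bar>x\<bar> * gcd A (gcd B C)" for x A B C :: int
  proof -
    have "gcd (x * B) (x * C) = \<bar>x * gcd B C\<bar>"
      by (simp add: gcd_mult_distrib_int[symmetric] abs_mult)
    then show ?thesis by (simp add: gcd_mult_distrib_int[symmetric])
  qed
  have A: "\<bar>A1\<bar> = \<bar>A2\<bar>"
    using gcd_mult[of A2 A1 B1 C1] gcd_mult[of A1 A2 B2 C2] g eq by (simp add: mult.commute)
  have B: "\<bar>B1\<bar> = \<bar>B2\<bar>"
    using gcd_mult[of B2 A1 B1 C1] gcd_mult[of B1 A2 B2 C2] g eq by (simp add: mult.commute)
  have C: "\<bar>C1\<bar> = \<bar>C2\<bar>"
    using gcd_mult[of C2 A1 B1 C1] gcd_mult[of C1 A2 B2 C2] g eq by (simp add: mult.commute)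
  show ?thesis
    using A B C eq by (auto simp: abs_eq_iff' abs_if split: if_splits)
qed

subsection \<open>Obstacles coming from lines\<close>

text \<open>The number 1638400 is 4 * 640^2, the largest of the factors in \<open>K_bounds\<close>;
  it comes from multiplying the slope of one line by the form of another.\<close>

locale bad_scheme = planar_curve +
  fixes \<rho> R :: real and \<kappa> :: nat
  assumes rho_pos: "0 < \<rho>" and R_gt_2: "2 < R"
    and kappa_K: "1638400 * K ^ 4 \<le> R powr \<kappa>"
    and kappa_rho: "\<rho> \<le> R powr \<kappa>" and kappa_inv_rho: "1 / \<rho> \<le> R powr \<kappa>"
begin

text \<open>Up to powers of R, e is the exponent of the constant c, stage 10 * k + e1 is the one at which the
  points with denominators between Q k and Q (k + 1) become collinear, and m0 measures
  how long a strip component must be (relative to c * Q k powr (-1-i)) in order to be declared early.\<close>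

definition m0 :: nat where "m0 = 10 * \<kappa> + 140"
definition e1 :: nat where "e1 = 2 * \<kappa> + 20"
definition e :: nat where "e = 100 * \<kappa> + 1000"
definition c :: real where "c = \<rho> * R powr (- real e)"
text \<open>Normalised so that Q^(1+i) is R^(10k). Then c Q^(-1-i) is exactly the length of the
  interval at stage 10 k + e.\<close>

definition \<theta> :: "nat \<Rightarrow> real" where "\<theta> k = 10 * real k / (1 + i)"
definition Q :: "nat \<Rightarrow> real" where "Q k = R powr \<theta> k"

definition nbhd :: "int \<Rightarrow> int \<Rightarrow> int \<Rightarrow> real set" where
  "nbhd p r q = {x\<in>{a..b}. \<bar>of_int q * x - of_int p\<bar> \<le> c * of_int q powr (- i) \<and>
                           \<bar>of_int q * f x - of_int r\<bar> \<le> c * of_int q powr (- j)}"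

definition at_scale :: "int \<Rightarrow> nat \<Rightarrow> bool" where
  "at_scale q k \<longleftrightarrow> 0 < q \<and> Q k \<le> of_int q \<and> of_int q < Q (Suc k)"

definition line_at_scale :: "int \<Rightarrow> int \<Rightarrow> int \<Rightarrow> nat \<Rightarrow> bool" where
  "line_at_scale A B C k \<longleftrightarrow> gcd A (gcd B C) = 1 \<and>
     \<bar>of_int A\<bar> \<le> Q k powr i \<and> \<bar>of_int B\<bar> \<le> Q k powr j"

text \<open>A component has level N if its length is just less than half of the length of the interval at
  stage N, so that N is its deadline.\<close>

definition piece :: "int \<Rightarrow> int \<Rightarrow> int \<Rightarrow> nat \<Rightarrow> nat \<Rightarrow> real \<Rightarrow> real \<Rightarrow> bool" where
  "piece A B C k N u w \<longleftrightarrow> line_at_scale A B C k \<and> {u..w} \<in> components (strip A B C (2 * c / Q k)) \<and>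
     u < w \<and> \<rho> * R powr (- real N - 1) \<le> 2 * (w - u) \<and> 2 * (w - u) < \<rho> * R powr (- real N)"

text \<open>The difference 10 k + e - N is the logarithmic size m of the component, and its tenth is
  the lead N - n. Raising k by one with N fixed raises this quotient by one, so n and N determine k,
  and only lines of one scale have to be compared.\<close>

definition line_obstacle :: "nat \<Rightarrow> nat \<Rightarrow> real set" where
  "line_obstacle n N = {x. \<exists>k A B C u w. piece A B C k N u w \<and> x \<in> {u..w} \<and>
     m0 + N \<le> 10 * k + e \<and> N = n + (10 * k + e - N) div 10}"

text \<open>N is the first level that is not declared early: a component of smaller level meets the
  \<open>m0\<close> condition of \<open>line_obstacle\<close>, and any other is shorter than half of
  the interval at stage N. Points on components of the first kind are therefore left out.\<close>

definition point_obstacle :: "nat \<Rightarrow> nat \<Rightarrow> real set" where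
  "point_obstacle n N = {x. \<exists>k p r q. n = 10 * k + e1 \<and> N + m0 = 10 * k + e + 1 \<and> at_scale q k \<and> x \<in> nbhd p r q \<and>
     (\<forall>n' N'. N' \<le> 10 * k + e \<longrightarrow> x \<notin> line_obstacle n' N')}"

definition obstacle :: "nat \<Rightarrow> nat \<Rightarrow> real set" where
  "obstacle n N = point_obstacle n N \<union> line_obstacle n N"

section \<open>Scales and exponents\<close>

lemma R_pos: "0 < R" and R_gt_1: "1 < R" using R_gt_2 by auto

lemma R_powr_le: "s \<le> t \<Longrightarrow> R powr s \<le> R powr t"
  using R_gt_1 by simp

lemma R_powr_less: "s < t \<Longrightarrow> R powr s < R powr t"
  using R_gt_1 by simp

lemma R_powr_cancel: "R powr s \<le> R powr t \<Longrightarrow> s \<le> t" "R powr s < R powr t \<Longrightarrow> s < t"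
  using R_gt_1 by simp_all

lemma R_powr_pos: "0 < R powr t" using R_pos by simp

lemma c_pos: "0 < c" using rho_pos R_pos by (simp add: c_def)

lemma theta: "\<theta> k * (1 + i) = 10 * real k" "\<theta> k * i + \<theta> k * j = \<theta> k"
   "5 * real k \<le> \<theta> k" "\<theta> k \<le> 20 / 3 * real k"
   "10 / 3 * real k \<le> \<theta> k * i" "0 \<le> \<theta> k"
proof -
  show eq: "\<theta> k * (1 + i) = 10 * real k" using i_pos by (simp add: \<theta>_def)
  show "\<theta> k * i + \<theta> k * j = \<theta> k" using i_plus_j by (simp add: distrib_left[symmetric])
  show nn: "0 \<le> \<theta> k" using i_pos by (simp add: \<theta>_def)
  have "\<theta> k * (1 + i) \<le> \<theta> k * 2" using nn i_less_1 by (intro mult_left_mono) auto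
  then show "5 * real k \<le> \<theta> k" using eq by simp
  have "\<theta> k * (3/2) \<le> \<theta> k * (1 + i)" using nn i_ge_half by (intro mult_left_mono) auto
  then show "\<theta> k \<le> 20 / 3 * real k" using eq by simp
  then show "10 / 3 * real k \<le> \<theta> k * i" using eq by (simp add: algebra_simps)
qed

lemma Q_powr: "Q k powr t = R powr (\<theta> k * t)"
  by (simp add: Q_def powr_powr)

lemma Q_ge_1: "1 \<le> Q k"
  using R_powr_le[of 0 "\<theta> k"] theta(6)[of k] R_pos by (simp add: Q_def)

lemma Q_pos: "0 < Q k" using Q_ge_1[of k] by simp

lemma two_c_over_Q: "2 * c / Q k = 2 * \<rho> * R powr (- real e - \<theta> k)"
  using R_pos by (simp add: c_def Q_def powr_diff)

lemma exists_scale: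
  assumes "0 < q"
  shows "\<exists>k. at_scale q k"
proof -
  define t where "t = log R (of_int q)"
  have q: "of_int q = R powr t" using assms R_gt_1 by (simp add: t_def)
  have "0 \<le> t" using assms R_gt_1 by (simp add: t_def)
  define k where "k = nat \<lfloor>t * (1 + i) / 10\<rfloor>"
  have pos: "0 \<le> t * (1 + i) / 10" using \<open>0 \<le> t\<close> i_pos by simp
  have "real k \<le> t * (1 + i) / 10" "t * (1 + i) / 10 < real (Suc k)"
  proof -
    have "real k = of_int \<lfloor>t * (1 + i) / 10\<rfloor>" using pos by (simp add: k_def)
    then show "real k \<le> t * (1 + i) / 10" "t * (1 + i) / 10 < real (Suc k)" by linarith+
  qed
  then have "\<theta> k \<le> t" "t < \<theta> (Suc k)"
    using i_pos by (simp_all add: \<theta>_def field_simps)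
  then show ?thesis
    using assms R_powr_le R_powr_less unfolding at_scale_def Q_def q by blast
qed

text \<open>The interval at stage n = N - s is at most 2 R^(s+1) times as long as the component;
  this ratio enters through its square, whence R^(2s+2). For the slope one factor of the interval
  length is divided out again, and R^(-m) appears on writing the strip width in terms of
  Q^i.\<close>

lemma piece_ball_bounds:
  assumes pc: "piece A B C k N u w" and m0: "m0 + N \<le> 10 * k + e" and N: "N = n + s"
    and ball: "{y..y + \<rho> * R powr (- real n)} \<subseteq> {a..b}"
    and t: "t \<in> {u..w}" "t \<in> {y..y + \<rho> * R powr (- real n)}"
    and x: "x \<in> {y..y + \<rho> * R powr (- real n)}"
  defines "m \<equiv> 10 * real k + real e - real N"
  shows "\<bar>slope A B x\<bar> \<le> 640 * K^2 * R powr (\<theta> k * i - m + s + 2)"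
    and "\<bar>line_form A B C x\<bar> \<le> 640 * K^2 * (c * R powr (- \<theta> k + 2 * s + 2))"
proof -
  define l where "l = \<rho> * R powr (- real n)"
  define d where "d = w - u"
  define h where "h = 2 * \<rho> * R powr (- real e - \<theta> k)"
  have l: "0 < l" using rho_pos R_pos by (simp add: l_def)
  have h: "0 \<le> h" using rho_pos by (simp add: h_def)
  have d: "0 < d" "\<rho> * R powr (- real N - 1) \<le> 2 * d" "2 * d < \<rho> * R powr (- real N)"
    and sub: "{u..w} \<subseteq> strip A B C h"
    using pc in_components_subset unfolding piece_def d_def two_c_over_Q h_def by auto
  have "\<rho> * R powr (- real N) \<le> l"
    unfolding l_def using rho_pos N by (intro mult_left_mono R_powr_le) auto
  then have dl: "d \<le> l" using d by linarith
  have uw: "u < w" "w - u \<le> l" using d(1) dl by (simp_all add: d_def)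
  have "l = \<rho> * R powr (- real N - 1) * R powr (s + 1)"
    using N by (simp add: l_def powr_add[symmetric] mult.assoc)
  also have "\<dots> \<le> 2 * d * R powr (s + 1)" using d(2) by (intro mult_right_mono) auto
  finally have ld: "l \<le> 2 * d * R powr (s + 1)" .
  have "l^2 \<le> (2 * d * R powr (s + 1))^2" using ld l by (intro power_mono) auto
  also have "\<dots> = d^2 * (4 * (R powr (s + 1) * R powr (s + 1)))"
    by (simp add: power2_eq_square)
  also have "\<dots> = d^2 * (4 * R powr (2 * s + 2))"
    unfolding powr_add[symmetric] by (simp add: algebra_simps)
  finally have l2: "l^2 \<le> d^2 * (4 * R powr (2 * s + 2))" .
  note bnd = strip_ball_bounds[OF sub uw ball[folded l_def] t(1) t(2)[folded l_def] x[folded l_def],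
      folded d_def]
  have dd: "0 < d^2" using d by simp
  have m_eq: "- real e - \<theta> k = \<theta> k * i - m - N"
    using theta(1)[of k] by (simp add: m_def algebra_simps)
  have "\<bar>slope A B x\<bar> * d^2 * l \<le> 78 * K^2 * h * l * l"
    using bnd(1) l by (intro mult_right_mono) auto
  also have "\<dots> = 78 * K^2 * h * l^2" by (simp add: power2_eq_square)
  also have "\<dots> \<le> 78 * K^2 * h * (d^2 * (4 * R powr (2 * s + 2)))"
    using h l2 by (intro mult_left_mono) auto
  finally have "(\<bar>slope A B x\<bar> * l) * d^2 \<le> (78 * K^2 * h * (4 * R powr (2 * s + 2))) * d^2"
    by (simp add: mult_ac)
  then have "\<bar>slope A B x\<bar> * l \<le> 78 * K^2 * h * (4 * R powr (2 * s + 2))"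
    using dd by (simp only: mult_le_cancel_right_pos)
  also have "\<dots> = (624 * K^2 * R powr (\<theta> k * i - m + s + 2)) * l"
  proof -
    have "R powr (- real e - \<theta> k) * R powr (2 * s + 2) = R powr (\<theta> k * i - m + s + 2) * R powr (- real n)"
      unfolding m_eq powr_add[symmetric] using N by (simp add: algebra_simps)
    then show ?thesis by (simp add: h_def l_def algebra_simps)
  qed
  finally have "\<bar>slope A B x\<bar> \<le> 624 * K^2 * R powr (\<theta> k * i - m + s + 2)"
    using l by (simp only: mult_le_cancel_right_pos)
  also have "\<dots> \<le> 640 * K^2 * R powr (\<theta> k * i - m + s + 2)"
    using R_pos by (intro mult_right_mono) auto
  finally show "\<bar>slope A B x\<bar> \<le> 640 * K^2 * R powr (\<theta> k * i - m + s + 2)" .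
  have "\<bar>line_form A B C x\<bar> * d^2 \<le> 79 * K^2 * h * l^2" by (rule bnd(2))
  also have "\<dots> \<le> 79 * K^2 * h * (d^2 * (4 * R powr (2 * s + 2)))"
    using h l2 by (intro mult_left_mono) auto
  finally have "\<bar>line_form A B C x\<bar> * d^2 \<le> (79 * K^2 * h * (4 * R powr (2 * s + 2))) * d^2"
    by (simp add: mult_ac)
  then have "\<bar>line_form A B C x\<bar> \<le> 79 * K^2 * h * (4 * R powr (2 * s + 2))"
    using dd by (simp only: mult_le_cancel_right_pos)
  also have "\<dots> = 632 * K^2 * (c * R powr (- \<theta> k + 2 * s + 2))"
  proof -
    have "R powr (- real e - \<theta> k) * R powr (2 * s + 2) = R powr (- real e) * R powr (- \<theta> k + 2 * s + 2)"
      unfolding powr_add[symmetric] by (simp add: algebra_simps)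
    then show ?thesis by (simp add: h_def c_def algebra_simps)
  qed
  also have "\<dots> \<le> 640 * K^2 * (c * R powr (- \<theta> k + 2 * s + 2))"
    using R_pos c_pos by (intro mult_right_mono) auto
  finally show "\<bar>line_form A B C x\<bar> \<le> 640 * K^2 * (c * R powr (- \<theta> k + 2 * s + 2))" .
qed

text \<open>Hence at stage 10 k + e every neighbourhood with denominator at scale k has been
  avoided. \<open>line_obstacle_cover\<close> uses this for smaller scales, and at the end it shows
  that avoiding all obstacles suffices.\<close>

lemma nbhd_in_obstacle:
  assumes "x \<in> nbhd p r q" "at_scale q k"
  shows "\<exists>n N. N \<le> 10 * k + e \<and> x \<in> obstacle n N"
proof (cases "\<exists>n N. N \<le> 10 * k + e \<and> x \<in> line_obstacle n N")
  case True
  then show ?thesis by (auto simp: obstacle_def)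
next
  case False
  have "x \<in> point_obstacle (10 * k + e1) (10 * k + e + 1 - m0)"
    unfolding point_obstacle_def using assms False by (auto simp: e_def m0_def)
  moreover have "10 * k + e + 1 - m0 \<le> 10 * k + e" by (simp add: m0_def)
  ultimately show ?thesis unfolding obstacle_def by blast
qed

lemma c_le: "c * R powr t \<le> R powr (\<kappa> - real e + t)"
proof -
  have "c * R powr t = \<rho> * R powr (- real e + t)" unfolding c_def powr_add by simp
  also have "\<dots> \<le> R powr \<kappa> * R powr (- real e + t)" using kappa_rho by (intro mult_right_mono) auto
  finally show ?thesis by (simp add: powr_add[symmetric] algebra_simps)
qed

lemma K_bounds: "1280 * K^2 * (2 * K) \<le> R powr \<kappa>" "2 * 640^2 * K^4 * 2 \<le> R powr \<kappa>" "1280 * K^2 \<le> R powr \<kappa>"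
  "288 * K \<le> R powr \<kappa>"
proof -
  have *: "x * K ^ n \<le> R powr \<kappa>" if "n \<le> 4" "x \<le> 1638400" "0 \<le> x" for x n
  proof -
    have "x * K ^ n \<le> 1638400 * K ^ 4"
      using that K_ge_1 by (intro mult_mono power_increasing) auto
    then show ?thesis using kappa_K by linarith
  qed
  show "1280 * K^2 * (2 * K) \<le> R powr \<kappa>" using *[of 3 2560] by (simp add: power3_eq_cube power2_eq_square)
  show "2 * 640^2 * K^4 * 2 \<le> R powr \<kappa>" using *[of 4 1638400] by simp
  show "1280 * K^2 \<le> R powr \<kappa>" using *[of 2 1280] by simp
  show "288 * K \<le> R powr \<kappa>" using *[of 1 288] by simp
qed

text \<open>If the two lines were not proportional, they would meet in a rational point (p/q, r/q) with q
  so small that its neighbourhood contains y and should have been avoided earlier.\<close>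

lemma pieces_same_strip:
  assumes pc1: "piece A1 B1 C1 k N u1 w1" and pc2: "piece A2 B2 C2 k N u2 w2"
    and m0: "m0 + N \<le> 10 * k + e" and N: "N = n + (10 * k + e - N) div 10"
    and ball: "{y..y + \<rho> * R powr (- real n)} \<subseteq> {a..b}"
    and t1: "t1 \<in> {u1..w1}" "t1 \<in> {y..y + \<rho> * R powr (- real n)}"
    and t2: "t2 \<in> {u2..w2}" "t2 \<in> {y..y + \<rho> * R powr (- real n)}"
    and avoid: "\<And>k' p r q. 10 * k' + e \<le> n \<Longrightarrow> at_scale q k' \<Longrightarrow>
        nbhd p r q \<inter> {y..y + \<rho> * R powr (- real n)} = {}"
  shows "strip A1 B1 C1 h = strip A2 B2 C2 h"
proof -
  define s where "s = (10 * k + e - N) div 10"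
  define m where "m = 10 * real k + real e - real N"
  \<comment> \<open>The exponent bounding the denominator of the intersection point: \<theta> k
    lowered by m - s, up to constants.\<close>
  define T where "T = \<kappa> + \<theta> k - m + s + 2"
  have y: "y \<in> {y..y + \<rho> * R powr (- real n)}" "y \<in> {a..b}"
  proof -
    have "0 \<le> \<rho> * R powr (- real n)" using rho_pos by simp
    then show "y \<in> {y..y + \<rho> * R powr (- real n)}" by simp
    then show "y \<in> {a..b}" using ball by blast
  qed
  have Ns: "N = n + s" using N by (simp add: s_def)
  have m_nat: "m = real (10 * k + e - N)" using m0 by (simp add: m_def)
  have sm: "10 * real s \<le> m" unfolding m_nat s_def by linarith
  have m_ge: "10 * real \<kappa> + 140 \<le> m" unfolding m_def using m0 by (simp add: m0_def)
  have m_le: "m \<le> 10 * real k + real e" by (simp add: m_def)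
  have \<kappa>_nn: "0 \<le> real \<kappa>" "0 \<le> real s" by simp_all
  have e_eq: "real e = 100 * \<kappa> + 1000" by (simp add: e_def)
  have n_eq: "real n = 10 * real k + real e - m - s" using Ns by (simp add: m_def)
  have mult_i: "i * \<kappa> \<le> \<kappa>" "i * s \<le> s" "m / 2 \<le> i * m" "0 \<le> i * \<kappa>" "0 \<le> i * s"
    using i_ge_half i_less_1 m_ge mult_right_mono[of "1/2" i m] by (auto simp: mult_left_le_one_le)
  have mult_j: "j * \<kappa> \<le> \<kappa>" "j * s \<le> s" "0 \<le> j * m"
    using j_pos j_less_1 m_ge by (auto simp: mult_left_le_one_le)
  note b1 = piece_ball_bounds[OF pc1 m0 Ns ball t1 y(1), folded m_def]
  note b2 = piece_ball_bounds[OF pc2 m0 Ns ball t2 y(1), folded m_def]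
  have B: "\<bar>of_int B1\<bar> \<le> R powr (\<theta> k * j)" "\<bar>of_int B2\<bar> \<le> R powr (\<theta> k * j)"
    using pc1 pc2 by (auto simp: piece_def line_at_scale_def Q_powr)
  define q p r where "q = A1 * B2 - A2 * B1" and "p = B1 * C2 - B2 * C1" and "r = A1 * C2 - A2 * C1"
  note ip = intersection_point(1)[of A1 B2 A2 B1 y, folded q_def]
    intersection_point(2)[of A1 B2 A2 B1 y C2 C1, folded q_def p_def]
    intersection_point(3)[of A1 B2 A2 B1 y C2 C1, folded q_def p_def r_def]
  define \<alpha> where "\<alpha> = of_int q * y - of_int p"
  define \<beta> where "\<beta> = slope A2 B2 y * line_form A1 B1 C1 y - slope A1 B1 y * line_form A2 B2 C2 y"
  have q_le: "\<bar>of_int q\<bar> \<le> R powr T"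
  proof -
    have "\<bar>of_int q\<bar> \<le> 2 * (640 * K^2 * R powr (\<theta> k * i - m + s + 2)) * R powr (\<theta> k * j)"
      unfolding ip(1) by (rule abs_mult_diff_le[OF b1(1) B(1) b2(1) B(2)])
    also have "\<dots> = 1280 * K^2 * R powr (\<theta> k * i - m + s + 2 + \<theta> k * j)"
      by (simp add: powr_add)
    also have "\<dots> \<le> R powr \<kappa> * R powr (\<theta> k * i - m + s + 2 + \<theta> k * j)"
      by (intro mult_right_mono K_bounds) simp
    also have "\<dots> = R powr T"
      unfolding powr_add[symmetric] T_def using theta(2)[of k] by (simp add: algebra_simps)
    finally show ?thesis .
  qed
  have \<alpha>_le: "K * \<bar>\<alpha>\<bar> \<le> c / 2 * R powr (\<kappa> - \<theta> k * i + 2 * s + 2)"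
  proof -
    have "\<alpha> = line_form A1 B1 C1 y * of_int B2 - line_form A2 B2 C2 y * of_int B1"
      unfolding \<alpha>_def ip(2) by simp
    then have "\<bar>\<alpha>\<bar> \<le> 2 * (640 * K^2 * (c * R powr (- \<theta> k + 2 * s + 2))) * R powr (\<theta> k * j)"
      using abs_mult_diff_le[OF b1(2) B(1) b2(2) B(2)] by simp
    also have "\<dots> = 1280 * K^2 * (c * R powr (- \<theta> k + 2 * s + 2 + \<theta> k * j))"
      by (simp add: powr_add)
    finally have "K * \<bar>\<alpha>\<bar> \<le> K * (1280 * K^2 * (c * R powr (- \<theta> k + 2 * s + 2 + \<theta> k * j)))"
      using K_ge_1 by (intro mult_left_mono) auto
    also have "\<dots> = (1280 * K^2 * (2 * K)) * (c / 2 * R powr (- \<theta> k + 2 * s + 2 + \<theta> k * j))"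
      by simp
    also have "\<dots> \<le> R powr \<kappa> * (c / 2 * R powr (- \<theta> k + 2 * s + 2 + \<theta> k * j))"
      using c_pos R_pos by (intro mult_right_mono K_bounds) auto
    also have "\<dots> = c / 2 * R powr (\<kappa> + (- \<theta> k + 2 * s + 2 + \<theta> k * j))"
      by (simp add: powr_add)
    also have "\<kappa> + (- \<theta> k + 2 * s + 2 + \<theta> k * j) = \<kappa> - \<theta> k * i + 2 * s + 2"
      using theta(2)[of k] by simp
    finally show ?thesis .
  qed
  have \<beta>_le: "\<bar>\<beta>\<bar> \<le> c / 2 * R powr (\<kappa> - \<theta> k * j - m + 3 * s + 4)"
  proof -
    have "\<bar>\<beta>\<bar> \<le> 2 * (640 * K^2 * R powr (\<theta> k * i - m + s + 2)) * (640 * K^2 * (c * R powr (- \<theta> k + 2 * s + 2)))"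
      unfolding \<beta>_def by (rule abs_mult_diff_le[OF b2(1) b2(2) b1(1) b1(2)])
    also have "\<dots> = (2 * 640^2 * K^4 * 2) * (c / 2 * R powr (\<theta> k * i - m + s + 2 + (- \<theta> k + 2 * s + 2)))"
      unfolding powr_add[of R "\<theta> k * i - m + s + 2"] by (simp add: power4_eq_xxxx power2_eq_square)
    also have "\<dots> \<le> R powr \<kappa> * (c / 2 * R powr (\<theta> k * i - m + s + 2 + (- \<theta> k + 2 * s + 2)))"
      using c_pos R_pos by (intro mult_right_mono K_bounds) auto
    also have "\<dots> = c / 2 * R powr (\<kappa> + (\<theta> k * i - m + s + 2 + (- \<theta> k + 2 * s + 2)))"
      by (simp add: powr_add)
    also have "\<kappa> + (\<theta> k * i - m + s + 2 + (- \<theta> k + 2 * s + 2)) = \<kappa> - \<theta> k * j - m + 3 * s + 4"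
      using theta(2)[of k] by simp
    finally show ?thesis .
  qed
  have qf: "of_int q * f y - of_int r = \<beta> + f' y * \<alpha>"
    unfolding \<alpha>_def \<beta>_def ip(3) by simp
  have f'\<alpha>: "\<bar>f' y * \<alpha>\<bar> \<le> K * \<bar>\<alpha>\<bar>"
    unfolding abs_mult using f'_le[OF y(2)] by (intro mult_right_mono) auto
  have \<alpha>K: "\<bar>\<alpha>\<bar> \<le> K * \<bar>\<alpha>\<bar>" using K_ge_1 by (simp add: mult_le_cancel_right1)
  have "q = 0"
  proof (rule ccontr)
    assume "q \<noteq> 0"
    define q' where "q' = \<bar>q\<bar>"
    have q': "0 < q'" "1 \<le> real_of_int q'" using \<open>q \<noteq> 0\<close> by (auto simp: q'_def)
    then obtain k' where k': "at_scale q' k'" using exists_scale by blast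
    have q'T: "real_of_int q' \<le> R powr T" using q_le by (simp add: q'_def)
    have "R powr \<theta> k' \<le> R powr T" using k' q'T by (simp add: at_scale_def Q_def)
    then have "\<theta> k' \<le> T" by (rule R_powr_cancel)
    then have "\<theta> k' * (1 + i) \<le> T * (1 + i)" using i_pos by (intro mult_right_mono) auto
    also have "\<dots> = 10 * real k + (1 + i) * (\<kappa> - m + s + 2)"
      using theta(1)[of k] by (simp add: T_def algebra_simps)
    \<comment> \<open>The bracket is negative and 1 + i is at least 3/2, so the gain is worth 3/2 (m
      - s) stages, up to constants. Since s \<le> m/10, this exceeds the m + s stages from n to 10 k
      + e by at least m/4, and m \<ge> 10 \<kappa> + 140 leaves room for the constants.\<close>
    also have "\<dots> \<le> 10 * real k + (3/2) * (\<kappa> - m + s + 2)"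
      using i_ge_half m_ge sm by (intro add_left_mono mult_right_mono_neg) auto
    finally have "10 * real k' \<le> 10 * real k + (3/2) * (\<kappa> - m + s + 2)"
      by (simp add: theta(1))
    then have "10 * real k' + real e \<le> real n"
      using n_eq m_ge sm \<kappa>_nn by (simp add: field_simps)
    then have kn: "10 * k' + e \<le> n" by linarith
    have powT: "R powr (- (x * T)) \<le> of_int q' powr (- x)" if "0 < x" for x
    proof -
      have "(R powr T) powr (- x) \<le> of_int q' powr (- x)"
        using that q' q'T by (intro powr_mono2') auto
      then show ?thesis by (simp add: powr_powr mult.commute)
    qed
    have "K * \<bar>\<alpha>\<bar> \<le> c / 2 * R powr (\<kappa> - \<theta> k * i + 2 * s + 2)" by (fact \<alpha>_le)
    \<comment> \<open>The term i m \<ge> m/2 hidden in - i T pays for the loss of 2 s.\<close>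
    also have "\<dots> \<le> c / 2 * R powr (- (i * T))"
    proof (intro mult_left_mono R_powr_le)
      have "i * T = i * \<kappa> + \<theta> k * i - i * m + i * s + 2 * i" by (simp add: T_def algebra_simps)
      then show "\<kappa> - \<theta> k * i + 2 * s + 2 \<le> - (i * T)"
        using mult_i sm m_ge i_less_1 \<kappa>_nn by linarith
    qed (use c_pos in simp)
    also have "\<dots> \<le> c / 2 * of_int q' powr (- i)"
      using c_pos by (intro mult_left_mono powT i_pos) simp
    finally have a: "K * \<bar>\<alpha>\<bar> \<le> c / 2 * of_int q' powr (- i)" .
    have "\<bar>\<beta>\<bar> \<le> c / 2 * R powr (\<kappa> - \<theta> k * j - m + 3 * s + 4)" by (fact \<beta>_le)
    also have "\<dots> \<le> c / 2 * R powr (- (j * T))"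
    proof (intro mult_left_mono R_powr_le)
      have "j * T = j * \<kappa> + \<theta> k * j - j * m + j * s + 2 * j" by (simp add: T_def algebra_simps)
      then show "\<kappa> - \<theta> k * j - m + 3 * s + 4 \<le> - (j * T)"
        using mult_j sm m_ge j_less_1 \<kappa>_nn by linarith
    qed (use c_pos in simp)
    also have "\<dots> \<le> c / 2 * of_int q' powr (- j)"
      using c_pos by (intro mult_left_mono powT j_pos) simp
    finally have b: "\<bar>\<beta>\<bar> \<le> c / 2 * of_int q' powr (- j)" .
    \<comment> \<open>The horizontal error reappears, times f', in the vertical one; because j \<le>
      i it fits the vertical tolerance. Each of the two contributions gets c/2.\<close>
    have "of_int q' powr (- i) \<le> real_of_int q' powr (- j)"
      using q' j_le_i by (intro powr_mono) auto
    then have ij: "c / 2 * of_int q' powr (- i) \<le> c / 2 * of_int q' powr (- j)"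
      using c_pos by (intro mult_left_mono) auto
    \<comment> \<open>Denominators at a scale are positive, so the point is rewritten with q, p and
      r multiplied by the sign of q.\<close>
    have sg: "real_of_int q' = of_int (sgn q) * of_int q"
      by (simp add: q'_def abs_sgn mult.commute)
    have sg1: "\<bar>real_of_int (sgn q)\<bar> = 1" using \<open>q \<noteq> 0\<close> by (simp add: sgn_if)
    have "\<bar>of_int q' * y - of_int (sgn q * p)\<bar> = \<bar>of_int (sgn q) * \<alpha>\<bar>"
      by (simp add: sg \<alpha>_def algebra_simps)
    also have "\<dots> = \<bar>\<alpha>\<bar>" using sg1 by (simp add: abs_mult)
    finally have \<alpha>_eq: "\<bar>of_int q' * y - of_int (sgn q * p)\<bar> = \<bar>\<alpha>\<bar>" .
    then have n1: "\<bar>of_int q' * y - of_int (sgn q * p)\<bar> \<le> c * of_int q' powr (- i)"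
    proof -
      have "0 \<le> c * of_int q' powr (- i)" using c_pos by simp
      then show ?thesis using a \<alpha>K \<alpha>_eq by linarith
    qed
    have "\<bar>of_int q' * f y - of_int (sgn q * r)\<bar> = \<bar>of_int (sgn q) * (of_int q * f y - of_int r)\<bar>"
      by (simp add: sg algebra_simps)
    also have "\<dots> = \<bar>\<beta> + f' y * \<alpha>\<bar>" using sg1 by (simp add: abs_mult qf)
    also have "\<dots> \<le> c * of_int q' powr (- j)"
      using a b ij f'\<alpha> by linarith
    finally have n2: "\<bar>of_int q' * f y - of_int (sgn q * r)\<bar> \<le> c * of_int q' powr (- j)" .
    have "y \<in> nbhd (sgn q * p) (sgn q * r) q'"
      using n1 n2 y(2) by (simp add: nbhd_def)
    then show False using avoid[OF kn k'] y(1) by blast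
  qed
  \<comment> \<open>For q = 0 the two errors are, up to sign, the integers p and, once p = 0, r;
    being below 1/2 they vanish, and the lines are proportional.\<close>
  have small: "c / 2 * R powr t < 1 / 2" if "\<kappa> - real e + t < 0" for t
    using c_le[of t] R_powr_less[OF that] R_pos by simp
  have "c / 2 * R powr (\<kappa> - \<theta> k * i + 2 * s + 2) < 1 / 2"
    using theta(5)[of k] sm m_le e_eq \<kappa>_nn by (intro small) linarith
  then have "\<bar>\<alpha>\<bar> < 1/2" using \<alpha>_le \<alpha>K by linarith
  then have "p = 0" using \<open>q = 0\<close> by (simp add: \<alpha>_def)
  then have "\<alpha> = 0" using \<open>q = 0\<close> by (simp add: \<alpha>_def)
  have "0 \<le> \<theta> k * j" using theta(6) j_pos by simp
  then have "c / 2 * R powr (\<kappa> - \<theta> k * j - m + 3 * s + 4) < 1 / 2"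
    using sm m_ge e_eq \<kappa>_nn by (intro small) linarith
  then have "\<bar>\<beta>\<bar> < 1/2" using \<beta>_le by linarith
  then have "r = 0" using qf \<open>q = 0\<close> \<open>\<alpha> = 0\<close> by simp
  have "(A2 = A1 \<and> B2 = B1 \<and> C2 = C1) \<or> (A2 = - A1 \<and> B2 = - B1 \<and> C2 = - C1)"
    using \<open>q = 0\<close> \<open>p = 0\<close> \<open>r = 0\<close> pc1 pc2
    by (intro primitive_parallel) (auto simp: q_def p_def r_def piece_def line_at_scale_def)
  then show ?thesis using strip_uminus by auto
qed

text \<open>If B is nonzero, |B| \<ge> 1 and curvature bounds the width. If B = 0, then A is
  nonzero, since otherwise |C| = 1 by coprimality and the form could not be below 1; the form then
  grows with rate |A| \<ge> 1, so d \<le> 2h, and h < 1 gives a bound of the same shape for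
  d^2.\<close>

lemma strip_width:
  assumes "line_at_scale A B C k" "u < w" "{u..w} \<subseteq> strip A B C (2 * c / Q k)"
  shows "(2 * (w - u))^2 \<le> \<rho> * R powr (\<kappa> - real e - \<theta> k)"
proof -
  define h where "h = 2 * c / Q k"
  define d where "d = w - u"
  have uw: "u < w" "{u..w} \<subseteq> strip A B C h" and g: "gcd A (gcd B C) = 1"
    using assms by (auto simp: h_def line_at_scale_def)
  have "c \<le> R powr (\<kappa> - real e)" using c_le[of 0] R_pos by simp
  also have "\<dots> \<le> R powr (- 2)" by (intro R_powr_le) (simp add: e_def)
  also have "R powr (-2) = 1 / R^2" using R_pos by (simp add: powr_minus divide_inverse)
  also have "\<dots> < 1 / 2^2" using R_gt_2 by (intro divide_strict_left_mono power_strict_mono) auto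
  finally have "2 * c < 1" by simp
  moreover have "h \<le> 2 * c" using Q_ge_1[of k] c_pos by (simp add: h_def field_simps)
  moreover have "0 < h" using c_pos Q_pos by (simp add: h_def)
  ultimately have h: "0 < h" "h < 1" by linarith+
  have "d^2 \<le> 36 * K * h"
  proof (cases "B = 0")
    case False
    then have "1 \<le> \<bar>real_of_int B\<bar>" by linarith
    then have "1 * d^2 \<le> \<bar>of_int B\<bar> * d^2" by (intro mult_right_mono) auto
    also have "\<dots> \<le> 36 * K * h" unfolding d_def by (rule strip_interval_bounds[OF uw(2,1), of u]) (use uw in auto)
    finally show ?thesis by simp
  next
    case True
    have u: "\<bar>line_form A B C u\<bar> \<le> h" "\<bar>line_form A B C w\<bar> \<le> h"
      using subsetD[OF uw(2), of u] subsetD[OF uw(2), of w] uw(1) by (simp_all add: strip_def)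
    have "A \<noteq> 0"
    proof
      assume "A = 0"
      then have "\<bar>C\<bar> = 1" using g True by simp
      then have "\<bar>real_of_int C\<bar> = 1" by linarith
      then show False using u(1) h True \<open>A = 0\<close> by (simp add: line_form_def)
    qed
    then have "1 \<le> \<bar>real_of_int A\<bar>" by linarith
    then have "1 * d \<le> \<bar>of_int A\<bar> * d" using uw by (intro mult_right_mono) (auto simp: d_def)
    also have "\<dots> = \<bar>line_form A B C w - line_form A B C u\<bar>"
      using uw True by (simp add: line_form_def d_def abs_mult flip: right_diff_distrib)
    also have "\<dots> \<le> 2 * h" using u by linarith
    finally have "d^2 \<le> (2 * h)^2" using uw by (intro power_mono) (auto simp: d_def)
    also have "\<dots> = 4 * h * h" by (simp add: power2_eq_square)
    also have "\<dots> \<le> 36 * K * h" using h K_ge_1 by (intro mult_mono) auto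
    finally show ?thesis .
  qed
  also have "\<dots> = 72 * K * \<rho> * R powr (- real e - \<theta> k)" by (simp add: h_def two_c_over_Q)
  finally have d2: "d^2 \<le> 72 * K * \<rho> * R powr (- real e - \<theta> k)" .
  have "(2 * d)^2 = 4 * d^2" by (simp add: power2_eq_square)
  also have "\<dots> \<le> 288 * K * \<rho> * R powr (- real e - \<theta> k)" using d2 by simp
  also have "\<dots> \<le> R powr \<kappa> * \<rho> * R powr (- real e - \<theta> k)"
    using rho_pos by (intro mult_right_mono K_bounds) auto
  also have "\<dots> = \<rho> * R powr (\<kappa> + (- real e - \<theta> k))" unfolding powr_add by simp
  also have "\<kappa> + (- real e - \<theta> k) = \<kappa> - real e - \<theta> k" by simp
  finally show ?thesis by (simp add: d_def)
qed

text \<open>A component has length at most of order sqrt(c/Q), so its level is at least about (5 k +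
  e)/2, far enough along to fit in the lead.\<close>

lemma piece_width:
  assumes "piece A B C k N u w"
  shows "5 * k + e \<le> 2 * N + 2 * \<kappa> + 2"
proof -
  have uw: "line_at_scale A B C k" "u < w" "{u..w} \<subseteq> strip A B C (2 * c / Q k)"
      "\<rho> * R powr (- real N - 1) \<le> 2 * (w - u)"
    using assms in_components_subset by (auto simp: piece_def)
  have "(\<rho> * R powr (- real N - 1))^2 \<le> (2 * (w - u))^2"
    using uw rho_pos by (intro power_mono) auto
  also have "\<dots> \<le> \<rho> * R powr (\<kappa> - real e - \<theta> k)" by (rule strip_width[OF uw(1-3)])
  also have "\<dots> = \<rho> * (R powr \<kappa> * R powr (- real e - \<theta> k))"
    unfolding powr_add[symmetric] by (simp add: algebra_simps)
  finally have "\<rho> * (\<rho> * (R powr (- real N - 1) * R powr (- real N - 1))) \<le> \<rho> * (R powr \<kappa> * R powr (- real e - \<theta> k))"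
    by (simp add: power2_eq_square mult_ac)
  then have "\<rho> * (R powr (- real N - 1) * R powr (- real N - 1)) \<le> R powr \<kappa> * R powr (- real e - \<theta> k)"
    using rho_pos by (simp only: mult_le_cancel_left_pos)
  then have "R powr (- real N - 1) * R powr (- real N - 1) \<le> (1 / \<rho>) * (R powr \<kappa> * R powr (- real e - \<theta> k))"
    using rho_pos by (simp add: field_simps)
  also have "\<dots> \<le> R powr \<kappa> * (R powr \<kappa> * R powr (- real e - \<theta> k))"
    using R_pos by (intro mult_right_mono kappa_inv_rho) auto
  finally have "- real N - 1 + (- real N - 1) \<le> \<kappa> + (\<kappa> + (- real e - \<theta> k))"
    unfolding powr_add[symmetric] by (rule R_powr_cancel)
  then have "real (5 * k + e) \<le> real (2 * N + 2 * \<kappa> + 2)"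
    using theta(3)[of k] by simp
  then show ?thesis by linarith
qed

text \<open>The declaration stage N - s is thus a true natural number and at least k. So only scales
  k \<le> n are declared at stage n, which bounds the deadlines by
  \<open>10 * n + e\<close>.\<close>

lemma piece_stage:
  assumes "piece A B C k N u w"
  shows "(10 * k + e - N) div 10 + k \<le> N"
  using piece_width[OF assms] by (simp add: e_def)

lemma obstacle_stages:
  assumes "obstacle n N \<noteq> {}"
  shows "n + 14 \<le> N \<and> N \<le> 10 * n + e"
proof -
  from assms consider "point_obstacle n N \<noteq> {}" | "line_obstacle n N \<noteq> {}" by (auto simp: obstacle_def)
  then show ?thesis
  proof cases
    case 1
    then obtain k where "n = 10 * k + e1" "N + m0 = 10 * k + e + 1" by (auto simp: point_obstacle_def)
    then show ?thesis by (simp add: e_def e1_def m0_def)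
  next
    case 2
    then obtain k A B C u w where k: "piece A B C k N u w" "m0 + N \<le> 10 * k + e" "N = n + (10 * k + e - N) div 10"
      by (auto simp: line_obstacle_def)
    have "k \<le> n" using piece_stage[OF k(1)] k(3) by linarith
    then show ?thesis using k(2,3) by (simp add: m0_def)
  qed
qed

lemma strip_cover:
  shows "\<exists>\<J>. finite \<J> \<and> card \<J> \<le> 2 \<and> (\<forall>p\<in>\<J>. 2 * (snd p - fst p) < \<delta>) \<and>
    (\<forall>u w x. {u..w} \<in> components (strip A B C h) \<longrightarrow> x \<in> {u..w} \<longrightarrow> 2 * (w - u) < \<delta> \<longrightarrow>
       x \<in> (\<Union>p\<in>\<J>. {fst p..snd p}))"
proof -
  let ?S = "{S \<in> components (strip A B C h). 2 * (Sup S - Inf S) < \<delta>}"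
  have fin: "finite ?S" using strip_components(1) by simp
  have "card ((\<lambda>S. (Inf S, Sup S)) ` ?S) \<le> card ?S" using fin by (rule card_image_le)
  also have "\<dots> \<le> card (components (strip A B C h))" using strip_components(1) by (intro card_mono) auto
  also have "\<dots> \<le> 2" by (rule strip_components)
  finally have "card ((\<lambda>S. (Inf S, Sup S)) ` ?S) \<le> 2" .
  moreover have "x \<in> (\<Union>p\<in>(\<lambda>S. (Inf S, Sup S)) ` ?S. {fst p..snd p})"
    if "{u..w} \<in> components (strip A B C h)" "x \<in> {u..w}" "2 * (w - u) < \<delta>" for u w x
    using that by (intro UN_I[of "(u, w)"]) (auto intro!: image_eqI[of _ _ "{u..w}"])
  ultimately show ?thesis
    using fin by (intro exI[of _ "(\<lambda>S. (Inf S, Sup S)) ` ?S"]) auto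
qed

lemma line_obstacle_cover:
  assumes ball: "{y..y + \<rho> * R powr (- real n)} \<subseteq> {a..b}"
    and avoid: "\<forall>n' N'. N' \<le> n \<longrightarrow> obstacle n' N' \<inter> {y..y + \<rho> * R powr (- real n)} = {}"
  shows "\<exists>\<J>. finite \<J> \<and> card \<J> \<le> 2 \<and> (\<forall>p\<in>\<J>. 2 * (snd p - fst p) < \<rho> * R powr (- real N)) \<and>
    line_obstacle n N \<inter> {y..y + \<rho> * R powr (- real n)} \<subseteq> (\<Union>p\<in>\<J>. {fst p..snd p})"
proof (cases "line_obstacle n N \<inter> {y..y + \<rho> * R powr (- real n)} = {}")
  case True
  then show ?thesis by (intro exI[of _ "{}"]) simp
next
  case False
  let ?I = "{y..y + \<rho> * R powr (- real n)}"
  have nb: "nbhd p r q \<inter> ?I = {}" if k': "10 * k' + e \<le> n" "at_scale q k'" for k' p r q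
  proof (rule ccontr)
    assume "nbhd p r q \<inter> ?I \<noteq> {}"
    then obtain x where x: "x \<in> nbhd p r q" "x \<in> ?I" by blast
    from x(1) k'(2) obtain n' N' where "N' \<le> 10 * k' + e" "x \<in> obstacle n' N'" using nbhd_in_obstacle by blast
    then show False using avoid[rule_format, of N' n'] k'(1) x(2) by force
  qed
  from False obtain t k A B C u w where w: "piece A B C k N u w" "t \<in> {u..w}" "t \<in> ?I"
      "m0 + N \<le> 10 * k + e" "N = n + (10 * k + e - N) div 10"
    unfolding line_obstacle_def by blast
  obtain \<J> where \<J>: "finite \<J>" "card \<J> \<le> 2" "\<forall>p\<in>\<J>. 2 * (snd p - fst p) < \<rho> * R powr (- real N)"
    "\<forall>u w x. {u..w} \<in> components (strip A B C (2 * c / Q k)) \<longrightarrow> x \<in> {u..w} \<longrightarrow> 2 * (w - u) < \<rho> * R powr (- real N) \<longrightarrow>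
       x \<in> (\<Union>p\<in>\<J>. {fst p..snd p})"
    using strip_cover[where \<delta> = "\<rho> * R powr (- real N)" and A = A and B = B and C = C and h = "2 * c / Q k"]
    by (elim exE conjE)
  have "line_obstacle n N \<inter> ?I \<subseteq> (\<Union>p\<in>\<J>. {fst p..snd p})"
  proof
    fix x assume "x \<in> line_obstacle n N \<inter> ?I"
    then obtain k' A' B' C' u' w' where w': "piece A' B' C' k' N u' w'" "x \<in> {u'..w'}" "x \<in> ?I"
        "m0 + N \<le> 10 * k' + e" "N = n + (10 * k' + e - N) div 10"
      unfolding line_obstacle_def by blast
    have "k' = k" using w(4,5) w'(4,5) by linarith
    then have "strip A B C (2 * c / Q k) = strip A' B' C' (2 * c / Q k)"
      using pieces_same_strip[OF w(1) _ w(4,5) ball w(2,3) w'(2,3) nb] w'(1) by simp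
    then show "x \<in> (\<Union>p\<in>\<J>. {fst p..snd p})"
      using w'(1) \<open>k' = k\<close> by (intro \<J>(4)[rule_format, OF _ w'(2)]) (auto simp: piece_def)
  qed
  with \<J>(1-3) show ?thesis by blast
qed

end

subsection \<open>Obstacles coming from rational points\<close>

text \<open>The integer is, up to sign, the determinant of the three vectors (p, r, q). Column
  operations turn it into that of the vectors (\<alpha>, \<gamma>, q), whose six terms are at most X
  Y U each; below 1 it must be 0.\<close>

lemma collinear_by_determinant:
  fixes p1 r1 q1 p2 r2 q2 p3 r3 q3 :: int and \<alpha>1 \<alpha>2 \<alpha>3 \<gamma>1 \<gamma>2 \<gamma>3 x y s X Y U :: real
  assumes p: "p1 = q1 * x - \<alpha>1" "p2 = q2 * x - \<alpha>2" "p3 = q3 * x - \<alpha>3"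
    and r: "r1 = q1 * y - s * \<alpha>1 - \<gamma>1" "r2 = q2 * y - s * \<alpha>2 - \<gamma>2" "r3 = q3 * y - s * \<alpha>3 - \<gamma>3"
    and \<alpha>: "\<bar>\<alpha>1\<bar> \<le> X" "\<bar>\<alpha>2\<bar> \<le> X" "\<bar>\<alpha>3\<bar> \<le> X" and \<gamma>: "\<bar>\<gamma>1\<bar> \<le> Y" "\<bar>\<gamma>2\<bar> \<le> Y" "\<bar>\<gamma>3\<bar> \<le> Y"
    and q: "\<bar>real_of_int q1\<bar> \<le> U" "\<bar>real_of_int q2\<bar> \<le> U" "\<bar>real_of_int q3\<bar> \<le> U"
    and small: "6 * X * Y * U < 1"
  shows "(r1 * q2 - r2 * q1) * p3 - (p1 * q2 - p2 * q1) * r3 + (p1 * r2 - p2 * r1) * q3 = 0"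
proof -
  let ?D = "(r1 * q2 - r2 * q1) * p3 - (p1 * q2 - p2 * q1) * r3 + (p1 * r2 - p2 * r1) * q3"
  have "real_of_int ?D = \<alpha>3 * (\<gamma>1 * q2 - \<gamma>2 * q1) - \<gamma>3 * (\<alpha>1 * q2 - \<alpha>2 * q1) + q3 * (\<alpha>1 * \<gamma>2 - \<alpha>2 * \<gamma>1)"
    by (simp add: p r algebra_simps)
  moreover have "\<bar>\<alpha>3 * (\<gamma>1 * q2 - \<gamma>2 * q1)\<bar> \<le> X * (2 * Y * U)"
    unfolding abs_mult using abs_mult_diff_le[OF \<gamma>(1) q(1) \<gamma>(2) q(2)] \<alpha> by (intro mult_mono) auto
  moreover have "\<bar>\<gamma>3 * (\<alpha>1 * q2 - \<alpha>2 * q1)\<bar> \<le> Y * (2 * X * U)"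
    unfolding abs_mult using abs_mult_diff_le[OF \<alpha>(1) q(1) \<alpha>(2) q(2)] \<gamma> by (intro mult_mono) auto
  moreover have "\<bar>q3 * (\<alpha>1 * \<gamma>2 - \<alpha>2 * \<gamma>1)\<bar> \<le> U * (2 * X * Y)"
    unfolding abs_mult using abs_mult_diff_le[OF \<alpha>(1) \<gamma>(1) \<alpha>(2) \<gamma>(2)] q by (intro mult_mono) auto
  ultimately have "\<bar>real_of_int ?D\<bar> \<le> 6 * X * Y * U" by (simp only:) argo
  then have "\<bar>real_of_int ?D\<bar> < 1" using small by linarith
  then show ?thesis by linarith
qed

context bad_scheme
begin

lemma exists_level:
  assumes "0 < d" "2 * d < \<rho>"
  shows "\<exists>N::nat. \<rho> * R powr (- real N - 1) \<le> 2 * d \<and> 2 * d < \<rho> * R powr (- real N)"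
proof -
  define t where "t = - log R (2 * d / \<rho>)"
  have d: "2 * d = \<rho> * R powr (- t)" using assms rho_pos R_gt_1 by (simp add: t_def)
  have "0 < t" using assms rho_pos R_gt_1 by (simp add: t_def)
  \<comment> \<open>The ceiling minus one instead of the floor, because the upper bound on the
    length is the strict one.\<close>
  define N where "N = nat (\<lceil>t\<rceil> - 1)"
  have "real N < t" "t \<le> real N + 1" using \<open>0 < t\<close> by (auto simp: N_def) linarith+
  then show ?thesis
    unfolding d using rho_pos by (intro exI[of _ N] conjI mult_left_mono mult_strict_left_mono R_powr_le R_powr_less) auto
qed

text \<open>Since the line contains (p/q, r/q), q times the form is A (q x - p) - B (q f x - r). The
  box Q^i, Q^j is dual to the tolerances c q^(-i), c q^(-j), so each term is at most c.\<close>

lemma nbhd_subset_strip: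
  assumes A: "\<bar>of_int A\<bar> \<le> Q k powr i" "\<bar>of_int B\<bar> \<le> Q k powr j"
    and q: "at_scale q k" and orth: "A * p - B * r + C * q = 0"
  shows "nbhd p r q \<subseteq> strip A B C (2 * c / Q k)"
proof
  fix x assume x: "x \<in> nbhd p r q"
  have qQ: "0 < real_of_int q" "Q k \<le> of_int q" using q by (auto simp: at_scale_def)
  have pw: "Q k powr t * (c * of_int q powr (- t)) \<le> c" if "0 < t" for t
  proof -
    have "Q k powr t \<le> of_int q powr t" using that qQ Q_pos[of k] by (intro powr_mono2) auto
    then have "Q k powr t * (c * of_int q powr (- t)) \<le> of_int q powr t * (c * of_int q powr (- t))"
      using c_pos by (intro mult_right_mono) auto
    also have "\<dots> = c" using qQ by (simp add: powr_minus)
    finally show ?thesis .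
  qed
  have "of_int C * real_of_int q = - (of_int A * of_int p - of_int B * of_int r)"
    using arg_cong[OF orth, of real_of_int] by simp
  then have "line_form A B C x * of_int q = of_int A * (of_int q * x - of_int p) - of_int B * (of_int q * f x - of_int r)"
    by (simp add: line_form_def algebra_simps)
  moreover have "\<bar>of_int A * (of_int q * x - of_int p)\<bar> \<le> Q k powr i * (c * of_int q powr (- i))"
    unfolding abs_mult using A x by (intro mult_mono) (auto simp: nbhd_def)
  moreover have "\<bar>of_int B * (of_int q * f x - of_int r)\<bar> \<le> Q k powr j * (c * of_int q powr (- j))"
    unfolding abs_mult using A x by (intro mult_mono) (auto simp: nbhd_def)
  ultimately have "\<bar>line_form A B C x * of_int q\<bar> \<le> 2 * c"
    using pw[OF i_pos] pw[OF j_pos] by linarith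
  then have "\<bar>line_form A B C x\<bar> * of_int q \<le> 2 * c" using qQ by (simp add: abs_mult)
  moreover have "\<bar>line_form A B C x\<bar> * Q k \<le> \<bar>line_form A B C x\<bar> * of_int q"
    using qQ by (intro mult_left_mono) auto
  ultimately have "\<bar>line_form A B C x\<bar> \<le> 2 * c / Q k" using Q_pos[of k] by (simp add: field_simps)
  then show "x \<in> strip A B C (2 * c / Q k)" using x by (simp add: strip_def nbhd_def)
qed

text \<open>Moves the inequalities from x to the common base point y. The vertical error is taken
  relative to the tangent at y, so only the two tolerances and the Taylor remainder enter.
  \<open>e1\<close> makes q times the interval length at most R^(-\<kappa>-13) Q^(-i), and 7 exceeds
  10/(1+i).\<close>

lemma nbhd_in_ball_bounds:
  assumes ball: "{y..y + \<rho> * R powr (- real (10 * k + e1))} \<subseteq> {a..b}"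
    and x: "x \<in> nbhd p r q" "x \<in> {y..y + \<rho> * R powr (- real (10 * k + e1))}" and q: "at_scale q k"
  defines "\<alpha> \<equiv> of_int q * y - of_int p"
  shows "\<bar>\<alpha>\<bar> \<le> R powr (- \<kappa> - 12 - \<theta> k * i)"
    and "\<bar>of_int q * f y - of_int r - f' y * \<alpha>\<bar> \<le> R powr (- 13 - \<theta> k * j)"
    and "\<bar>real_of_int q\<bar> \<le> R powr (\<theta> k + 7)"
proof -
  define l where "l = \<rho> * R powr (- real (10 * k + e1))"
  have l0: "0 \<le> l" using rho_pos by (simp add: l_def)
  have xy: "y \<in> {a..b}" "x \<in> {a..b}" "\<bar>x - y\<bar> \<le> l" using x(2) ball by (auto simp: l_def)
  have qQ: "0 < real_of_int q" "R powr \<theta> k \<le> of_int q" "of_int q < R powr \<theta> (Suc k)"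
    using q by (auto simp: at_scale_def Q_def)
  have "10 / (1 + i) \<le> 7" using i_ge_half by (simp add: field_simps)
  then have th: "\<theta> (Suc k) \<le> \<theta> k + 7" by (simp add: \<theta>_def add_divide_distrib)
  then show q7: "\<bar>real_of_int q\<bar> \<le> R powr (\<theta> k + 7)"
    using qQ R_powr_le[OF th] by linarith
  have cq: "c * of_int q powr (- t) \<le> R powr (- \<kappa> - 13 - \<theta> k * t)" if "0 < t" for t
  proof -
    have "of_int q powr (- t) \<le> (R powr \<theta> k) powr (- t)"
      using that qQ R_pos by (intro powr_mono2') auto
    then have "c * of_int q powr (- t) \<le> c * R powr (- (\<theta> k * t))"
      using c_pos by (simp add: powr_powr)
    also have "\<dots> \<le> R powr (\<kappa> - real e + - (\<theta> k * t))" by (rule c_le)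
    also have "\<dots> \<le> R powr (- \<kappa> - 13 - \<theta> k * t)" by (intro R_powr_le) (simp add: e_def)
    finally show ?thesis .
  qed
  have ql: "of_int q * l \<le> R powr (- \<kappa> - 13 - \<theta> k * i)"
  proof -
    have "of_int q * l \<le> R powr (\<theta> k + 7) * (R powr \<kappa> * R powr (- real (10 * k + e1)))"
      unfolding l_def using q7 qQ rho_pos kappa_rho by (intro mult_mono) auto
    also have "\<dots> = R powr (\<theta> k + 7 + (\<kappa> + - real (10 * k + e1)))"
      unfolding powr_add ..
    also have "\<theta> k + 7 + (\<kappa> + - real (10 * k + e1)) = - \<kappa> - 13 - \<theta> k * i"
      using theta(1)[of k] by (simp add: e1_def algebra_simps)
    finally show ?thesis .
  qed
  have l1: "l \<le> 1"
  proof -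
    have "l \<le> R powr \<kappa> * R powr (- real (10 * k + e1))"
      unfolding l_def using kappa_rho by (intro mult_right_mono) auto
    also have "\<dots> \<le> R powr 0" unfolding powr_add[symmetric] by (intro R_powr_le) (simp add: e1_def)
    finally show ?thesis using R_pos by simp
  qed
  have two: "2 * R powr t \<le> R powr (t + 1)" for t
    using R_gt_2 R_pos by (simp add: powr_add)
  have nb: "\<bar>of_int q * x - of_int p\<bar> \<le> c * of_int q powr (- i)" "\<bar>of_int q * f x - of_int r\<bar> \<le> c * of_int q powr (- j)"
    using x(1) by (auto simp: nbhd_def)
  have qxy: "\<bar>of_int q * (y - x)\<bar> \<le> of_int q * l"
    unfolding abs_mult using qQ xy(3) by (intro mult_mono) auto
  have "\<alpha> = (of_int q * x - of_int p) + of_int q * (y - x)" by (simp add: \<alpha>_def algebra_simps)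
  then have "\<bar>\<alpha>\<bar> \<le> 2 * R powr (- \<kappa> - 13 - \<theta> k * i)"
    using nb(1) cq[OF i_pos] qxy ql by linarith
  also have "\<dots> \<le> R powr (- \<kappa> - 13 - \<theta> k * i + 1)" by (rule two)
  also have "- \<kappa> - 13 - \<theta> k * i + 1 = - \<kappa> - 12 - \<theta> k * i" by simp
  finally show "\<bar>\<alpha>\<bar> \<le> R powr (- \<kappa> - 12 - \<theta> k * i)" .
  have ij: "R powr (- \<kappa> - 13 - \<theta> k * i) \<le> R powr (- \<kappa> - 13 - \<theta> k * j)"
    using theta(6)[of k] j_le_i by (intro R_powr_le) (simp add: mult_left_mono)
  let ?E = "R powr (- \<kappa> - 13 - \<theta> k * j)"
  have eq: "of_int q * f y - of_int r - f' y * \<alpha> =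
      (of_int q * f x - of_int r) - f' y * (of_int q * x - of_int p) - of_int q * (f x - f y - f' y * (x - y))"
    by (simp add: \<alpha>_def algebra_simps)
  have t1: "\<bar>of_int q * f x - of_int r\<bar> \<le> K * ?E"
  proof -
    have "\<bar>of_int q * f x - of_int r\<bar> \<le> 1 * ?E" using nb(2) cq[OF j_pos] by simp
    also have "\<dots> \<le> K * ?E" using K_ge_1 by (intro mult_right_mono) auto
    finally show ?thesis .
  qed
  have t2: "\<bar>f' y * (of_int q * x - of_int p)\<bar> \<le> K * ?E"
    unfolding abs_mult using f'_le[OF xy(1)] nb(1) cq[OF i_pos] ij by (intro mult_mono) auto
  have t3: "\<bar>of_int q * (f x - f y - f' y * (x - y))\<bar> \<le> K * ?E"
  proof -
    have "\<bar>f x - f y - f' y * (x - y)\<bar> \<le> K * (x - y)^2" by (rule f_taylor[OF xy(1,2)])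
    also have "(x - y)^2 \<le> l^2" using xy(3) by (metis abs_le_square_iff abs_of_nonneg l0)
    also have "l^2 \<le> l * 1" unfolding power2_eq_square using l0 l1 by (intro mult_left_mono) auto
    finally have "\<bar>f x - f y - f' y * (x - y)\<bar> \<le> K * l" using K_ge_1 by simp
    then have "\<bar>of_int q * (f x - f y - f' y * (x - y))\<bar> \<le> of_int q * (K * l)"
      unfolding abs_mult using qQ by (intro mult_mono) auto
    also have "\<dots> = K * (of_int q * l)" by simp
    also have "\<dots> \<le> K * ?E" using ql ij K_ge_1 by (intro mult_left_mono) auto
    finally show ?thesis .
  qed
  have "\<bar>of_int q * f y - of_int r - f' y * \<alpha>\<bar> \<le> 3 * K * ?E"
    unfolding eq using t1 t2 t3 by linarith
  also have "\<dots> \<le> R powr \<kappa> * ?E"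
  proof (intro mult_right_mono)
    have "3 * K \<le> 288 * K" using K_ge_1 by simp
    then show "3 * K \<le> R powr \<kappa>" using K_bounds(4) by linarith
  qed simp
  also have "\<dots> = R powr (- 13 - \<theta> k * j)" unfolding powr_add[symmetric] by simp
  finally show "\<bar>of_int q * f y - of_int r - f' y * \<alpha>\<bar> \<le> R powr (- 13 - \<theta> k * j)" .
qed

text \<open>The line is the cross product of two of the points, divided by its content; its
  coefficients A and B are minors of errors against denominators and so fit the box. Different
  abscissas make B nonzero, hence the content positive.\<close>

lemma common_line:
  assumes ball: "{y..y + \<rho> * R powr (- real (10 * k + e1))} \<subseteq> {a..b}"
    and P1: "at_scale q1 k" "x1 \<in> nbhd p1 r1 q1" "x1 \<in> {y..y + \<rho> * R powr (- real (10 * k + e1))}"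
    and P2: "at_scale q2 k" "x2 \<in> nbhd p2 r2 q2" "x2 \<in> {y..y + \<rho> * R powr (- real (10 * k + e1))}"
    and ne: "p1 * q2 \<noteq> p2 * q1"
  shows "\<exists>A B C. line_at_scale A B C k \<and>
    (\<forall>p r q x. at_scale q k \<longrightarrow> x \<in> nbhd p r q \<longrightarrow> x \<in> {y..y + \<rho> * R powr (- real (10 * k + e1))} \<longrightarrow>
       A * p - B * r + C * q = 0)"
proof -
  define A B C where "A = r1 * q2 - r2 * q1" and "B = p1 * q2 - p2 * q1" and "C = p1 * r2 - p2 * r1"
  define \<alpha> where "\<alpha> = (\<lambda>p q. real_of_int q * y - real_of_int p)"
  define \<gamma> where "\<gamma> = (\<lambda>p r q. real_of_int q * f y - real_of_int r - f' y * \<alpha> p q)"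
  define X where "X = R powr (- \<kappa> - 12 - \<theta> k * i)"
  define Y where "Y = R powr (- 13 - \<theta> k * j)"
  define U where "U = R powr (\<theta> k + 7)"
  have bnd: "\<bar>\<alpha> p q\<bar> \<le> X" "\<bar>\<gamma> p r q\<bar> \<le> Y" "\<bar>real_of_int q\<bar> \<le> U"
    if "at_scale q k" "x \<in> nbhd p r q" "x \<in> {y..y + \<rho> * R powr (- real (10 * k + e1))}" for p r q x
    using nbhd_in_ball_bounds[OF ball that(2,3,1)] by (simp_all add: \<alpha>_def \<gamma>_def X_def Y_def U_def)
  have "6 * X * Y * U = 6 * R powr (- \<kappa> - 18)"
  proof -
    have "X * Y * U = R powr ((- \<kappa> - 12 - \<theta> k * i) + (- 13 - \<theta> k * j) + (\<theta> k + 7))"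
      unfolding X_def Y_def U_def powr_add ..
    also have "(- \<kappa> - 12 - \<theta> k * i) + (- 13 - \<theta> k * j) + (\<theta> k + 7) = - \<kappa> - 18"
      using theta(2)[of k] by simp
    finally show ?thesis by simp
  qed
  also have "\<dots> \<le> 6 * R powr (- 3)" by (intro mult_left_mono R_powr_le) auto
  also have "\<dots> < 1"
  proof -
    have "(2::real)^3 < R^3" using R_gt_2 by (intro power_strict_mono) auto
    then show ?thesis using R_pos by (simp add: powr_minus field_simps)
  qed
  finally have small: "6 * X * Y * U < 1" .
  have p_eq: "real_of_int p = of_int q * y - \<alpha> p q" for p q by (simp add: \<alpha>_def)
  have r_eq: "real_of_int r = of_int q * f y - f' y * \<alpha> p q - \<gamma> p r q" for p r q by (simp add: \<gamma>_def)
  have orth: "A * p - B * r + C * q = 0"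
    if "at_scale q k" "x \<in> nbhd p r q" "x \<in> {y..y + \<rho> * R powr (- real (10 * k + e1))}" for p r q x
    unfolding A_def B_def C_def
    by (rule collinear_by_determinant[OF p_eq p_eq p_eq r_eq r_eq r_eq bnd(1)[OF P1] bnd(1)[OF P2] bnd(1)[OF that]
        bnd(2)[OF P1] bnd(2)[OF P2] bnd(2)[OF that] bnd(3)[OF P1] bnd(3)[OF P2] bnd(3)[OF that] small])
  have two: "2 \<le> R powr t" if "1 \<le> t" for t
    using R_powr_le[OF that] R_gt_2 R_pos by simp
  have XU: "2 * X * U \<le> R powr (\<theta> k * j)"
  proof -
    have "2 * (X * U) \<le> R powr 1 * (X * U)" by (intro mult_right_mono two) (auto simp: X_def U_def)
    then have "2 * X * U \<le> R powr 1 * (X * U)" by simp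
    also have "\<dots> = R powr (1 + ((- \<kappa> - 12 - \<theta> k * i) + (\<theta> k + 7)))"
      unfolding X_def U_def powr_add ..
    also have "\<dots> \<le> R powr (\<theta> k * j)" using theta(2)[of k] by (intro R_powr_le) linarith
    finally show ?thesis .
  qed
  have B: "\<bar>real_of_int B\<bar> \<le> R powr (\<theta> k * j)"
  proof -
    have "real_of_int B = \<alpha> p2 q2 * q1 - \<alpha> p1 q1 * q2"
      by (simp add: B_def \<alpha>_def algebra_simps)
    then have "\<bar>real_of_int B\<bar> \<le> 2 * X * U"
      using abs_mult_diff_le[OF bnd(1)[OF P2] bnd(3)[OF P2] bnd(1)[OF P1] bnd(3)[OF P1]] by simp
    then show ?thesis using XU by linarith
  qed
  have A: "\<bar>real_of_int A\<bar> \<le> R powr (\<theta> k * i)"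
  proof -
    let ?W = "R powr (- 11 - \<theta> k * j)"
    have W: "\<bar>real_of_int q * f y - real_of_int r\<bar> \<le> ?W"
      if "at_scale q k" "x \<in> nbhd p r q" "x \<in> {y..y + \<rho> * R powr (- real (10 * k + e1))}" for p r q x
    proof -
      have "y \<in> {a..b}" using that(3) ball by force
      then have "\<bar>f' y * \<alpha> p q\<bar> \<le> K * X"
        unfolding abs_mult using f'_le bnd(1)[OF that] K_ge_1 by (intro mult_mono) auto
      also have "\<dots> \<le> R powr \<kappa> * X"
        using K_bounds(4) K_ge_1 by (intro mult_right_mono) (auto simp: X_def)
      also have "\<dots> = R powr (\<kappa> + (- \<kappa> - 12 - \<theta> k * i))" unfolding X_def powr_add ..
      also have "\<dots> \<le> R powr (- 12 - \<theta> k * j)"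
        using mult_left_mono[OF j_le_i theta(6)[of k]] by (intro R_powr_le) linarith
      finally have "\<bar>f' y * \<alpha> p q\<bar> \<le> R powr (- 12 - \<theta> k * j)" .
      moreover have "Y \<le> R powr (- 12 - \<theta> k * j)" unfolding Y_def by (intro R_powr_le) simp
      moreover have "real_of_int q * f y - real_of_int r = \<gamma> p r q + f' y * \<alpha> p q" by (simp add: \<gamma>_def)
      ultimately have "\<bar>real_of_int q * f y - real_of_int r\<bar> \<le> 2 * R powr (- 12 - \<theta> k * j)"
        using bnd(2)[OF that] by linarith
      also have "\<dots> \<le> R powr 1 * R powr (- 12 - \<theta> k * j)" using two[of 1] by (intro mult_right_mono) auto
      also have "\<dots> = R powr (1 + (- 12 - \<theta> k * j))" unfolding powr_add ..
      finally show ?thesis by simp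
    qed
    have "real_of_int A = (q2 * f y - r2) * q1 - (q1 * f y - r1) * q2"
      by (simp add: A_def algebra_simps)
    then have "\<bar>real_of_int A\<bar> \<le> 2 * ?W * U"
      using abs_mult_diff_le[OF W[OF P2] bnd(3)[OF P2] W[OF P1] bnd(3)[OF P1]] by simp
    also have "2 * ?W * U = 2 * (?W * U)" by simp
    also have "\<dots> \<le> R powr 1 * (?W * U)" by (intro mult_right_mono two) (auto simp: U_def)
    also have "\<dots> = R powr (1 + ((- 11 - \<theta> k * j) + (\<theta> k + 7)))"
      unfolding U_def powr_add ..
    also have "\<dots> \<le> R powr (\<theta> k * i)" using theta(2)[of k] by (intro R_powr_le) linarith
    finally show ?thesis .
  qed
  define g where "g = gcd A (gcd B C)"
  have "B \<noteq> 0" using ne by (simp add: B_def)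
  then have g: "0 < g" by (simp add: g_def)
  obtain A' where A': "A = g * A'" by (metis g_def gcd_dvd1 dvdE)
  obtain B' where B': "B = g * B'" by (metis g_def gcd_dvd1 gcd_dvd2 dvd_trans dvdE)
  obtain C' where C': "C = g * C'" by (metis g_def gcd_dvd2 dvd_trans dvdE)
  have "g = g * gcd A' (gcd B' C')"
    using g by (subst (1) g_def) (simp add: A' B' C' gcd_mult_distrib_int[symmetric])
  then have prim: "gcd A' (gcd B' C') = 1" using g by simp
  have shrink: "\<bar>real_of_int z\<bar> \<le> \<bar>real_of_int (g * z)\<bar>" for z
  proof -
    have "1 * \<bar>real_of_int z\<bar> \<le> \<bar>real_of_int g\<bar> * \<bar>real_of_int z\<bar>"
      using g by (intro mult_right_mono) auto
    then show ?thesis by (simp add: abs_mult)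
  qed
  have "line_at_scale A' B' C' k"
    using prim A B shrink[of A'] shrink[of B'] unfolding line_at_scale_def Q_powr A' B' by linarith
  moreover have "A' * p - B' * r + C' * q = 0" if "A * p - B * r + C * q = 0" for p r q
  proof -
    have "g * (A' * p - B' * r + C' * q) = 0" using that by (simp add: A' B' C' algebra_simps)
    then show ?thesis using g by simp
  qed
  ultimately show ?thesis using orth by blast
qed

text \<open>For the exceptional case in which all points lie above one abscissa: dividing the
  horizontal inequality by q leaves the radius c Q^(-1-i).\<close>

lemma nbhd_same_abscissa:
  assumes "at_scale q k" "x \<in> nbhd p r q" "at_scale q0 k" "p * q0 = p0 * q"
  shows "\<bar>x - of_int p0 / of_int q0\<bar> \<le> c * R powr (- real (10 * k))"
proof -
  have q: "0 < real_of_int q" "R powr \<theta> k \<le> of_int q" and q0: "0 < real_of_int q0"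
    using assms(1,3) by (auto simp: at_scale_def Q_def)
  have "real_of_int p * of_int q0 = of_int p0 * of_int q"
    using arg_cong[OF assms(4), of real_of_int] by simp
  then have eq: "of_int p0 / of_int q0 = real_of_int p / of_int q" using q q0 by (simp add: field_simps)
  have "of_int q powr (- i) \<le> (R powr \<theta> k) powr (- i)"
    using i_pos q R_pos by (intro powr_mono2') auto
  then have "c * of_int q powr (- i) \<le> c * R powr (- (\<theta> k * i))"
    using c_pos by (simp add: powr_powr)
  then have "\<bar>of_int q * x - of_int p\<bar> \<le> c * R powr (- (\<theta> k * i))"
    using assms(2) by (simp add: nbhd_def)
  moreover have "\<bar>x - of_int p / of_int q\<bar> * of_int q = \<bar>of_int q * x - of_int p\<bar>"
    using q by (simp add: abs_mult[symmetric] field_simps flip: abs_mult_pos)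
  moreover have "\<bar>x - of_int p / of_int q\<bar> * R powr \<theta> k \<le> \<bar>x - of_int p / of_int q\<bar> * of_int q"
    using q by (intro mult_left_mono) auto
  ultimately have "\<bar>x - of_int p / of_int q\<bar> * R powr \<theta> k \<le> c * R powr (- (\<theta> k * i))" by linarith
  also have "\<dots> = c * R powr (- real (10 * k)) * R powr \<theta> k"
  proof -
    have "R powr (- real (10 * k)) * R powr \<theta> k = R powr (- real (10 * k) + \<theta> k)" unfolding powr_add ..
    also have "- real (10 * k) + \<theta> k = - (\<theta> k * i)" using theta(1)[of k] by (simp add: algebra_simps)
    finally show ?thesis by simp
  qed
  finally show ?thesis unfolding eq by (simp only: mult_le_cancel_right_pos[OF R_powr_pos])
qed

text \<open>Points above one abscissa need one short interval. Otherwise all lie in the strip of one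
  line, and a component too long for the deadline N is a piece of level below N, hence part of a
  line obstacle, whose points were excluded by definition.\<close>

lemma point_obstacle_cover:
  assumes ball: "{y..y + \<rho> * R powr (- real n)} \<subseteq> {a..b}"
  shows "\<exists>\<J>. finite \<J> \<and> card \<J> \<le> 2 \<and> (\<forall>p\<in>\<J>. 2 * (snd p - fst p) < \<rho> * R powr (- real N)) \<and>
    point_obstacle n N \<inter> {y..y + \<rho> * R powr (- real n)} \<subseteq> (\<Union>p\<in>\<J>. {fst p..snd p})"
proof (cases "point_obstacle n N \<inter> {y..y + \<rho> * R powr (- real n)} = {}")
  case True
  then show ?thesis by (intro exI[of _ "{}"]) simp
next
  case False
  then obtain x0 k p0 r0 q0 where n: "n = 10 * k + e1" and N: "N + m0 = 10 * k + e + 1"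
    and P0: "at_scale q0 k" "x0 \<in> nbhd p0 r0 q0" "x0 \<in> {y..y + \<rho> * R powr (- real (10 * k + e1))}"
    unfolding point_obstacle_def by blast
  let ?I = "{y..y + \<rho> * R powr (- real (10 * k + e1))}"
  have point_D: "\<exists>p r q. at_scale q k \<and> x \<in> nbhd p r q \<and> (\<forall>n' N'. N' \<le> 10 * k + e \<longrightarrow> x \<notin> line_obstacle n' N')"
    if "x \<in> point_obstacle n N" for x
    using that unfolding point_obstacle_def n by force
  show ?thesis
  proof (cases "\<forall>p r q x. at_scale q k \<longrightarrow> x \<in> nbhd p r q \<longrightarrow> x \<in> ?I \<longrightarrow> p * q0 = p0 * q")
    case True
    define \<eta> where "\<eta> = c * R powr (- real (10 * k))"
    define z where "z = real_of_int p0 / of_int q0"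
    have "point_obstacle n N \<inter> ?I \<subseteq> {z - \<eta>..z + \<eta>}"
    proof
      fix x assume x: "x \<in> point_obstacle n N \<inter> ?I"
      then obtain p r q where pq: "at_scale q k" "x \<in> nbhd p r q" using point_D by blast
      then have "p * q0 = p0 * q" using True x by blast
      from nbhd_same_abscissa[OF pq P0(1) this] show "x \<in> {z - \<eta>..z + \<eta>}"
        by (auto simp: z_def \<eta>_def abs_le_iff)
    qed
    moreover have "2 * (2 * \<eta>) < \<rho> * R powr (- real N)"
    proof -
      have "4 * \<eta> = 4 * (\<rho> * R powr (- real e + - real (10 * k)))"
        unfolding \<eta>_def c_def powr_add by simp
      also have "\<dots> < R^2 * (\<rho> * R powr (- real e + - real (10 * k)))"
        using R_gt_2 rho_pos R_pos power_strict_mono[of 2 R 2] by (intro mult_strict_right_mono) auto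
      also have "\<dots> = \<rho> * R powr (2 + (- real e + - real (10 * k)))"
        unfolding powr_add using R_pos by simp
      also have "\<dots> \<le> \<rho> * R powr (- real N)"
        using N rho_pos by (intro mult_left_mono R_powr_le) (auto simp: m0_def)
      finally show ?thesis by simp
    qed
    ultimately show ?thesis unfolding n by (intro exI[of _ "{(z - \<eta>, z + \<eta>)}"]) auto
  next
    case False
    then obtain p1 r1 q1 x1 where P1: "at_scale q1 k" "x1 \<in> nbhd p1 r1 q1" "x1 \<in> ?I" and ne: "p1 * q0 \<noteq> p0 * q1"
      by blast
    obtain A B C where L: "line_at_scale A B C k"
        and orth: "\<forall>p r q x. at_scale q k \<longrightarrow> x \<in> nbhd p r q \<longrightarrow> x \<in> ?I \<longrightarrow> A * p - B * r + C * q = 0"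
      using common_line[OF ball[unfolded n] P1 P0 ne] by blast
    have box: "\<bar>of_int A\<bar> \<le> Q k powr i" "\<bar>of_int B\<bar> \<le> Q k powr j"
      using L by (auto simp: line_at_scale_def)
    obtain \<J> where \<J>: "finite \<J>" "card \<J> \<le> 2" "\<forall>p\<in>\<J>. 2 * (snd p - fst p) < \<rho> * R powr (- real N)"
      "\<forall>u w x. {u..w} \<in> components (strip A B C (2 * c / Q k)) \<longrightarrow> x \<in> {u..w} \<longrightarrow> 2 * (w - u) < \<rho> * R powr (- real N) \<longrightarrow>
       x \<in> (\<Union>p\<in>\<J>. {fst p..snd p})"
      using strip_cover[where \<delta> = "\<rho> * R powr (- real N)" and A = A and B = B and C = C and h = "2 * c / Q k"]
      by (elim exE conjE)
    have "x \<in> (\<Union>p\<in>\<J>. {fst p..snd p})" if x: "x \<in> point_obstacle n N" "x \<in> ?I" for x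
    proof -
      obtain p r q where pq: "at_scale q k" "x \<in> nbhd p r q" and not_line: "\<And>n' N'. N' \<le> 10 * k + e \<Longrightarrow> x \<notin> line_obstacle n' N'"
        using point_D[OF x(1)] by blast
      have "A * p - B * r + C * q = 0" using orth pq x(2) by blast
      from nbhd_subset_strip[OF box pq(1) this] have "x \<in> strip A B C (2 * c / Q k)" using pq(2) by blast
      then obtain S where S: "S \<in> components (strip A B C (2 * c / Q k))" "x \<in> S"
        by (metis Union_components UnionE)
      then obtain u w where uw: "u \<le> w" "S = {u..w}" using strip_component_interval by metis
      have "2 * (w - u) < \<rho> * R powr (- real N)"
      proof (rule ccontr)
        assume big: "\<not> 2 * (w - u) < \<rho> * R powr (- real N)"
        moreover have pos: "0 < \<rho> * R powr (- real N)" using rho_pos R_pos by simp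
        ultimately have "0 < 2 * (w - u)" by linarith
        then have "u < w" by simp
        have sub: "{u..w} \<subseteq> strip A B C (2 * c / Q k)" using S(1) uw(2) in_components_subset by blast
        \<comment> \<open>A level exists only for components shorter than \<rho>/2; the width bound
          together with 1/\<rho> \<le> R^\<kappa> provides this.\<close>
        have "(2 * (w - u))^2 \<le> \<rho> * R powr (\<kappa> - real e - \<theta> k)" by (rule strip_width[OF L \<open>u < w\<close> sub])
        also have "\<dots> < \<rho> * R powr (- real \<kappa>)"
          using rho_pos theta(6)[of k] by (intro mult_strict_left_mono R_powr_less) (auto simp: e_def)
        also have "\<dots> \<le> \<rho> * \<rho>"
        proof (intro mult_left_mono)
          have "1 \<le> \<rho> * R powr \<kappa>" using kappa_inv_rho rho_pos by (simp add: field_simps)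
          then show "R powr (- real \<kappa>) \<le> \<rho>" using R_pos by (simp add: powr_minus field_simps)
        qed (use rho_pos in simp)
        finally have "(2 * (w - u))^2 < \<rho>^2" by (simp add: power2_eq_square)
        then have "2 * (w - u) < \<rho>"
          by (rule power_less_imp_less_base) (use rho_pos in simp)
        then obtain N' where N': "\<rho> * R powr (- real N' - 1) \<le> 2 * (w - u)" "2 * (w - u) < \<rho> * R powr (- real N')"
          using exists_level[of "w - u"] \<open>u < w\<close> by auto
        have "\<rho> * R powr (- real N) < \<rho> * R powr (- real N')" using N'(2) big by linarith
        then have "R powr (- real N) < R powr (- real N')" using rho_pos by (simp only: mult_less_cancel_left_pos)
        then have "- real N < - real N'" by (rule R_powr_cancel)
        then have NN: "N' < N" by simp
        have pc: "piece A B C k N' u w"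
          unfolding piece_def using L S(1) uw(2) \<open>u < w\<close> N' by simp
        have st: "(10 * k + e - N') div 10 \<le> N'" using piece_stage[OF pc] by simp
        have m: "m0 + N' \<le> 10 * k + e" using NN N by simp
        have "N' = (N' - (10 * k + e - N') div 10) + (10 * k + e - N') div 10" using st by simp
        with pc m S(2) uw(2) have "x \<in> line_obstacle (N' - (10 * k + e - N') div 10) N'"
          unfolding line_obstacle_def by blast
        moreover have "N' \<le> 10 * k + e" using m by simp
        ultimately show False using not_line by blast
      qed
      then show ?thesis using \<J>(4) S uw(2) by blast
    qed
    with \<J>(1-3) show ?thesis unfolding n by blast
  qed
qed

lemma avoidance_scheme_obstacle: "avoidance_scheme (1 / R) {a..b} \<rho> obstacle (\<lambda>n. 10 * n + e)"
  unfolding avoidance_scheme_def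
proof (intro conjI allI impI)
  fix n N assume "obstacle n N \<noteq> {}"
  then show "n + 14 \<le> N" "N \<le> 10 * n + e" using obstacle_stages by blast+
next
  fix n N y
  have pw: "(1 / R) ^ n = R powr (- real n)" for n
    using R_pos by (simp add: powr_minus powr_realpow power_one_over inverse_eq_divide)
  assume "{y..y + \<rho> * (1 / R) ^ n} \<subseteq> {a..b}"
    and "\<forall>n' N'. N' \<le> n \<longrightarrow> obstacle n' N' \<inter> {y..y + \<rho> * (1 / R) ^ n} = {}"
  then have ball: "{y..y + \<rho> * R powr (- real n)} \<subseteq> {a..b}"
    and avoid: "\<forall>n' N'. N' \<le> n \<longrightarrow> obstacle n' N' \<inter> {y..y + \<rho> * R powr (- real n)} = {}"
    unfolding pw by blast+
  obtain \<J>1 where \<J>1: "finite \<J>1" "card \<J>1 \<le> 2" "\<forall>p\<in>\<J>1. 2 * (snd p - fst p) < \<rho> * R powr (- real N)"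
    "point_obstacle n N \<inter> {y..y + \<rho> * R powr (- real n)} \<subseteq> (\<Union>p\<in>\<J>1. {fst p..snd p})"
    using point_obstacle_cover[OF ball, where N = N] by (elim exE conjE)
  obtain \<J>2 where \<J>2: "finite \<J>2" "card \<J>2 \<le> 2" "\<forall>p\<in>\<J>2. 2 * (snd p - fst p) < \<rho> * R powr (- real N)"
    "line_obstacle n N \<inter> {y..y + \<rho> * R powr (- real n)} \<subseteq> (\<Union>p\<in>\<J>2. {fst p..snd p})"
    using line_obstacle_cover[OF ball avoid, where N = N] by (elim exE conjE)
  have "card (\<J>1 \<union> \<J>2) \<le> 4" using card_Un_le[of \<J>1 \<J>2] \<J>1(2) \<J>2(2) by linarith
  then have "covering (obstacle n N \<inter> {y..y + \<rho> * R powr (- real n)}) (\<rho> * R powr (- real N)) (\<J>1 \<union> \<J>2)"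
    using \<J>1 \<J>2 unfolding covering_def obstacle_def by blast
  then show "\<exists>\<J>. covering (obstacle n N \<inter> {y..y + \<rho> * (1 / R) ^ n}) (\<rho> * (1 / R) ^ N) \<J>"
    unfolding pw by blast
qed

lemma outside_obstacles_imp_Bad_curve:
  assumes x: "x \<in> {a..b}" and out: "\<And>n N. x \<notin> obstacle n N"
  shows "x \<in> Bad_curve {a..b} f i j"
proof -
  have c1: "c < 1"
  proof -
    have "c \<le> R powr (\<kappa> - real e)" using c_le[of 0] R_pos by simp
    also have "\<dots> < R powr 0" by (intro R_powr_less) (simp add: e_def)
    finally show ?thesis using R_pos by simp
  qed
  \<comment> \<open>One constant has to serve both coordinates after taking the powers 1/i and 1/j.
    The power 1/j is exact for the second, and c < 1 with j \<le> i makes it small enough for the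
    first.\<close>
  define c0 where "c0 = c powr (1 / j)"
  have c0: "0 < c0" using c_pos by (simp add: c0_def)
  have c0j: "c0 powr j = c" using c_pos j_pos by (simp add: c0_def powr_powr)
  have c0i: "c0 powr i \<le> c"
  proof -
    have "c0 powr i = c powr (i / j)" by (simp add: c0_def powr_powr)
    also have "\<dots> \<le> c powr 1" using c_pos c1 j_pos j_le_i by (intro powr_mono') (auto simp: field_simps)
    finally show ?thesis using c_pos by simp
  qed
  have "c0 / real q < max (dist_int (real q * x) powr (1 / i)) (dist_int (real q * f x) powr (1 / j))"
    if q: "1 \<le> q" for q :: nat
  proof (rule ccontr)
    assume nlt: "\<not> ?thesis"
    have close: "dist_int t \<le> c * real q powr (- s)"
      if "dist_int t powr (1 / s) \<le> c0 / real q" "0 < s" "c0 powr s \<le> c" for t s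
    proof -
      have d0: "0 \<le> dist_int t" by (simp add: dist_int_def)
      have "dist_int t = (dist_int t powr (1 / s)) powr s" using that(2) d0 by (simp add: powr_powr)
      also have "\<dots> \<le> (c0 / real q) powr s" using that(1,2) by (intro powr_mono2) auto
      also have "\<dots> = c0 powr s * real q powr (- s)"
        using c0 q by (simp add: powr_divide powr_minus_divide)
      also have "\<dots> \<le> c * real q powr (- s)" using that(3) by (intro mult_right_mono) auto
      finally show ?thesis .
    qed
    have "dist_int (real q * x) \<le> c * real q powr (- i)"
      using nlt i_pos c0i by (intro close) auto
    moreover have "dist_int (real q * f x) \<le> c * real q powr (- j)"
      using nlt j_pos c0j by (intro close) auto
    ultimately have "x \<in> nbhd (round (real q * x)) (round (real q * f x)) (int q)"
      using x by (simp add: nbhd_def dist_int_def)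
    moreover obtain k where "at_scale (int q) k" using exists_scale[of "int q"] q by auto
    ultimately show False using nbhd_in_obstacle out by blast
  qed
  then show ?thesis
    using x c0 unfolding Bad_curve_def Bad_def by auto
qed

end

subsection \<open>The winning property\<close>

lemma exists_curve_constant:
  fixes f' f'' :: "real \<Rightarrow> real"
  assumes ab: "a < b"
    and f': "\<And>x. x \<in> {a..b} \<Longrightarrow> (f' has_real_derivative f'' x) (at x within {a..b})"
    and cont: "continuous_on {a..b} f''" and nz: "\<And>x. x \<in> {a..b} \<Longrightarrow> f'' x \<noteq> 0"
  shows "\<exists>K\<ge>1. (\<forall>x\<in>{a..b}. \<bar>f' x\<bar> \<le> K \<and> \<bar>f'' x\<bar> \<le> K) \<and>
    ((\<forall>x\<in>{a..b}. 1 / K \<le> f'' x) \<or> (\<forall>x\<in>{a..b}. f'' x \<le> - (1 / K)))"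
proof -
  have ne: "{a..b} \<noteq> {}" using ab by simp
  have "continuous_on {a..b} f'" using f' by (intro DERIV_continuous_on) auto
  note cont' = continuous_on_rabs[OF this] continuous_on_rabs[OF cont]
  obtain x1 where x1: "\<forall>x\<in>{a..b}. \<bar>f' x\<bar> \<le> \<bar>f' x1\<bar>"
    using continuous_attains_sup[OF compact_Icc ne cont'(1)] by blast
  obtain x2 where x2: "\<forall>x\<in>{a..b}. \<bar>f'' x\<bar> \<le> \<bar>f'' x2\<bar>"
    using continuous_attains_sup[OF compact_Icc ne cont'(2)] by blast
  obtain x3 where x3: "x3 \<in> {a..b}" "\<forall>x\<in>{a..b}. \<bar>f'' x3\<bar> \<le> \<bar>f'' x\<bar>"
    using continuous_attains_inf[OF compact_Icc ne cont'(2)] by blast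
  define K where "K = max 1 (max \<bar>f' x1\<bar> (max \<bar>f'' x2\<bar> (1 / \<bar>f'' x3\<bar>)))"
  have K: "1 \<le> K" "\<bar>f' x1\<bar> \<le> K" "\<bar>f'' x2\<bar> \<le> K" "1 / \<bar>f'' x3\<bar> \<le> K"
    by (simp_all add: K_def le_max_iff_disj)
  have "1 / K \<le> \<bar>f'' x3\<bar>" using K(1,4) nz[OF x3(1)] by (simp add: field_simps)
  then have low: "1 / K \<le> \<bar>f'' x\<bar>" if "x \<in> {a..b}" for x using x3(2) that by force
  have "(\<forall>x\<in>{a..b}. 0 < f'' x) \<or> (\<forall>x\<in>{a..b}. f'' x < 0)"
  proof (rule ccontr)
    assume "\<not> ?thesis"
    then obtain x y where xy: "x \<in> {a..b}" "y \<in> {a..b}" "f'' x \<le> 0" "0 \<le> f'' y"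
      by (meson linorder_le_less_linear less_imp_le)
    have "connected (f'' ` {a..b})" using cont by (intro connected_continuous_image) auto
    then have "{f'' x..f'' y} \<subseteq> f'' ` {a..b}" using xy by (intro connected_contains_Icc) auto
    then have "0 \<in> f'' ` {a..b}" using xy by auto
    then show False using nz by auto
  qed
  then have "(\<forall>x\<in>{a..b}. 1 / K \<le> f'' x) \<or> (\<forall>x\<in>{a..b}. f'' x \<le> - (1 / K))"
    using low by (force simp: abs_if)
  moreover have "\<forall>x\<in>{a..b}. \<bar>f' x\<bar> \<le> K \<and> \<bar>f'' x\<bar> \<le> K"
    using x1 x2 K by force
  ultimately show ?thesis using K(1) by blast
qed

lemma exists_powr_ge:
  fixes R :: real
  assumes "1 < R"
  shows "\<exists>\<kappa>::nat. x \<le> R powr \<kappa>"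
proof -
  obtain n where "x < R ^ n" using real_arch_pow[OF assms] by blast
  then show ?thesis using assms by (intro exI[of _ n]) (simp add: powr_realpow)
qed

theorem theorem4:
  fixes i j a b :: real and f f' f'' :: "real \<Rightarrow> real"
  assumes "0 < j" and "j \<le> i" and "i < 1" and "i + j = 1"
    and "a < b"
    and "\<And>x. x \<in> {a..b} \<Longrightarrow> (f has_real_derivative f' x) (at x within {a..b})"
    and "\<And>x. x \<in> {a..b} \<Longrightarrow> (f' has_real_derivative f'' x) (at x within {a..b})"
    and "continuous_on {a..b} f''"
    and "\<And>x. x \<in> {a..b} \<Longrightarrow> f'' x \<noteq> 0"
  shows "alpha_winning (1 / 2) {a..b} (Bad_curve {a..b} f i j)"
proof -
  obtain K where K: "1 \<le> K" "\<forall>x\<in>{a..b}. \<bar>f' x\<bar> \<le> K \<and> \<bar>f'' x\<bar> \<le> K"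
      "(\<forall>x\<in>{a..b}. 1 / K \<le> f'' x) \<or> (\<forall>x\<in>{a..b}. f'' x \<le> - (1 / K))"
    using exists_curve_constant[OF assms(5,7,8,9)] by blast
  interpret planar_curve i j a b K f f' f''
    using assms K by unfold_locales auto
  show ?thesis
    unfolding alpha_winning_def
  proof (intro allI impI, elim conjE)
    fix \<beta> :: real assume \<beta>: "0 < \<beta>" "\<beta> < 1"
    define R where "R = 2 / \<beta>"
    have R: "2 < R" "\<beta> / 2 = 1 / R" using \<beta> by (auto simp: R_def field_simps)
    show "game_winning (1 / 2) \<beta> {a..b} (Bad_curve {a..b} f i j)"
    proof (rule game_winning_if_avoidance[OF \<beta>])
      show "Bad_curve {a..b} f i j \<subseteq> {a..b}" by (auto simp: Bad_curve_def)
      fix \<rho> :: real assume \<rho>: "0 < \<rho>"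
      obtain \<kappa> :: nat where "max (1638400 * K ^ 4) (max \<rho> (1 / \<rho>)) \<le> R powr \<kappa>"
        using exists_powr_ge[of R] R(1) by fastforce
      then interpret bad_scheme i j a b K f f' f'' \<rho> R \<kappa>
        using \<rho> R(1) by unfold_locales auto
      show "\<exists>Z bnd. avoidance_scheme (\<beta> / 2) {a..b} \<rho> Z bnd \<and>
          (\<forall>x\<in>{a..b}. (\<forall>n N. x \<notin> Z n N) \<longrightarrow> x \<in> Bad_curve {a..b} f i j)"
        unfolding R(2) using avoidance_scheme_obstacle outside_obstacles_imp_Bad_curve by blast
    qed
  qed
qed

end
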